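(* Let $(\Psi^j)_{j=0}^\infty$ be a frame-generating sequence with $\Psi^j\in\Pi_{N_j}(\mathbb{S}^{d-1})$ for each $j\in\mathbb{N}_0$. Define a sequence of polynomials $(\tilde\Psi^j)_{j=0}^\infty$ on $\mathbb{S}^{d-1}$ through their Fourier coefficients $$\tilde\Psi^j(n,k)=\sigma_n^{-1}\,\Psi^j(n,k),\qquad\text{where}\quad \sigma_n=(\dim\mathcal{H}_n^d)^{-1}\sum_{j=0}^\infty\sum_{k\in\mathcal{I}_n^d}|\Psi^j(n,k)|^2 .$$ Then the system $\mathcal{X}[(\tilde\Psi^j)_{j=0}^\infty]$ is the canonical dual frame of $\mathcal{X}[(\Psi^j)_{j=0}^\infty]$.
   Context: Fix $d\ge3$. $\mathbb{S}^{d-1}$ is the unit sphere in $\mathbb{R}^d$ and $\omega_{d-1}$ is the rotation-invariant measure on it normalized by $\omega_{d-1}(\mathbb{S}^{d-1})=1$; $L^2(\mathbb{S}^{d-1})$ (complex-valued functions) has inner product $\langle f_1,f_2\rangle_{\mathbb{S}^{d-1}}=\int f_1\overline{f_2}\,\mathrm{d}\omega_{d-1}$. $\mathcal{H}_n^d$ is the space of spherical harmonics of degree $n$ (restrictions to $\mathbb{S}^{d-1}$ of complex harmonic homogeneous polynomials of degree $n$ on $\mathbb{R}^d$), and $\Pi_N(\mathbb{S}^{d-1})=\bigoplus_{n=0}^N\mathcal{H}_n^d$ is the space of restrictions to the sphere of polynomials of degree at most $N$. For each $n\in\mathbb{N}_0$, $\mathcal{I}_n^d$ is an index set of cardinality $\dim\mathcal{H}_n^d$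 and $\{Y_k^{d,n}: k\in\mathcal{I}_n^d\}$ is a fixed orthonormal basis of $\mathcal{H}_n^d$. Fourier coefficients are written $f(n,k)=\langle f,Y_k^{d,n}\rangle_{\mathbb{S}^{d-1}}$. $\mu_d$ is the normalized Haar measure on $SO(d)$, and $(T^d(g)f)(x)=f(g^{-1}x)$ for $g\in SO(d)$. Let $t_{k,m}^{d,n}(g)=\langle T^d(g)Y_m^{d,n},Y_k^{d,n}\rangle_{\mathbb{S}^{d-1}}$ and $\mathcal{M}_N^1(SO(d))=\mathrm{span}\{t_{k,m}^{d,n}: k,m\in\mathcal{I}_n^d,\ 0\le n\le N\}$. Fix an increasing sequence $(N_j)_{j=0}^\infty\subset\mathbb{N}_0$ and, for every $j\in\mathbb{N}_0$, points $g_{j,r}\in SO(d)$ and weights $\mu_{j,r}>0$, $r=1,\dots,r_j$, such that $$\int_{SO(d)}f_1f_2\,\mathrm{d}\mu_d=\sum_{r=1}^{r_j}\mu_{j,r}f_1(g_{j,r})f_2(g_{j,r})\quad\text{for all } f_1,f_2\in\mathcal{M}_{N_j}^1(SO(d)).$$ For a sequence $(\Psi^j)_{j=0}^\infty$ with $\Psi^j\in\Pi_{N_j}(\mathbb{S}^{d-1})$ put $$\mathcal{X}[(\Psi^j)_{j=0}^\infty]=\{\sqrt{\mu_{j,r}}\,T^d(g_{j,r})\Psi^j:\ r=1,\dots,r_j,\ j\in\mathbb{N}_0\},$$ regarded as a (canonically ordered) sequence of elements of $L^2(\mathbb{S}^{d-1})$. The sequence $(\Psi^j)_{j=0}^\infty$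 is called frame-generating if $\mathcal{X}[(\Psi^j)_{j=0}^\infty]$ is a frame for $L^2(\mathbb{S}^{d-1})$. The canonical dual frame of a frame $(\varphi_i)_i$ with frame operator $Sf=\sum_i\langle f,\varphi_i\rangle\varphi_i$ is $(S^{-1}\varphi_i)_i$. *)

theory Defs
  imports "HOL-Analysis.Analysis" "HOL-Library.Function_Algebras"
begin

section \<open>Complex vector spaces of functions\<close>

global_interpretation cfun: vector_space "\<lambda>(c::complex) (f::'a \<Rightarrow> complex) x. c * f x"
  defines cfun_span = cfun.span
    and cfun_dim = cfun.dim
  by unfold_locales (auto simp: fun_eq_iff algebra_simps)

section \<open>Square-integrable functions and frames\<close>

text \<open>
  Elements of the Hilbert space of square-integrable functions are represented by functions;
  two of them are the same element iff they agree almost everywhere.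
\<close>

definition L2 :: "'a measure \<Rightarrow> ('a \<Rightarrow> complex) set" where
  "L2 M = {f \<in> borel_measurable M. integrable M (\<lambda>x. (cmod (f x))\<^sup>2)}"

definition L2_inner :: "'a measure \<Rightarrow> ('a \<Rightarrow> complex) \<Rightarrow> ('a \<Rightarrow> complex) \<Rightarrow> complex" where
  "L2_inner M f g = (LINT x|M. f x * cnj (g x))"

definition L2_norm :: "'a measure \<Rightarrow> ('a \<Rightarrow> complex) \<Rightarrow> real" where
  "L2_norm M f = sqrt (LINT x|M. (cmod (f x))\<^sup>2)"

definition is_frame :: "'a measure \<Rightarrow> 'i set \<Rightarrow> ('i \<Rightarrow> 'a \<Rightarrow> complex) \<Rightarrow> bool" where
  "is_frame M J \<phi> \<longleftrightarrow>
     (\<forall>i\<in>J. \<phi> i \<in> L2 M) \<and>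
     (\<exists>A B. 0 < A \<and> A \<le> B \<and>
       (\<forall>f\<in>L2 M.
          (\<lambda>i. (cmod (L2_inner M f (\<phi> i)))\<^sup>2) summable_on J \<and>
          A * (L2_norm M f)\<^sup>2 \<le> (\<Sum>\<^sub>\<infinity>i\<in>J. (cmod (L2_inner M f (\<phi> i)))\<^sup>2) \<and>
          (\<Sum>\<^sub>\<infinity>i\<in>J. (cmod (L2_inner M f (\<phi> i)))\<^sup>2) \<le> B * (L2_norm M f)\<^sup>2))"

text \<open>
  \<open>frame_operator_maps M J \<phi> f h\<close> says \<open>S f = h\<close> for the frame operator \<open>S\<close> of \<open>\<phi>\<close>, the series
  converging in norm.  Frame series converge unconditionally, so summing along the finite
  subsets of \<open>J\<close> gives the same operator as summing in any fixed order of \<open>J\<close>.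
\<close>

definition frame_operator_maps ::
  "'a measure \<Rightarrow> 'i set \<Rightarrow> ('i \<Rightarrow> 'a \<Rightarrow> complex) \<Rightarrow> ('a \<Rightarrow> complex) \<Rightarrow> ('a \<Rightarrow> complex) \<Rightarrow> bool" where
  "frame_operator_maps M J \<phi> f h \<longleftrightarrow>
     f \<in> L2 M \<and> h \<in> L2 M \<and>
     ((\<lambda>F. L2_norm M (\<lambda>x. h x - (\<Sum>i\<in>F. L2_inner M f (\<phi> i) * \<phi> i x))) \<longlongrightarrow> 0)
       (finite_subsets_at_top J)"

text \<open>
  \<open>\<psi> i = S\<inverse> (\<phi> i)\<close>: the functions mapped by \<open>S\<close> to \<open>\<phi> i\<close> are exactly the representatives
  of the class of \<open>\<psi> i\<close>.
\<close>

definition is_canonical_dual_frame ::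
  "'a measure \<Rightarrow> 'i set \<Rightarrow> ('i \<Rightarrow> 'a \<Rightarrow> complex) \<Rightarrow> ('i \<Rightarrow> 'a \<Rightarrow> complex) \<Rightarrow> bool" where
  "is_canonical_dual_frame M J \<phi> \<psi> \<longleftrightarrow>
     is_frame M J \<phi> \<and>
     (\<forall>i\<in>J. \<psi> i \<in> L2 M \<and>
        (\<forall>f\<in>L2 M. frame_operator_maps M J \<phi> f (\<phi> i) \<longleftrightarrow> (AE x in M. f x = \<psi> i x)))"

section \<open>Rotations and invariant measures\<close>

definition SO :: "(real^'d^'d) set" where
  "SO = {g. rotation_matrix g}"

definition is_normalized_Haar_SO :: "(real^'d^'d) measure \<Rightarrow> bool" where
  "is_normalized_Haar_SO \<mu> \<longleftrightarrow>
     space \<mu> = SO \<and> sets \<mu> = sets (restrict_space borel SO) \<and> emeasure \<mu> SO = 1 \<and>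
     (\<forall>h\<in>SO. distr \<mu> \<mu> (\<lambda>g. h ** g) = \<mu>)"

definition is_normalized_sphere_measure :: "(real^'d) measure \<Rightarrow> bool" where
  "is_normalized_sphere_measure \<omega> \<longleftrightarrow>
     space \<omega> = sphere 0 1 \<and> sets \<omega> = sets (restrict_space borel (sphere 0 1)) \<and>
     emeasure \<omega> (sphere 0 1) = 1 \<and>
     (\<forall>h\<in>SO. distr \<omega> \<omega> (\<lambda>x. h *v x) = \<omega>)"

definition rot_action :: "real^'d^'d \<Rightarrow> (real^'d \<Rightarrow> complex) \<Rightarrow> (real^'d \<Rightarrow> complex)" where
  "rot_action g f = (\<lambda>x. f (matrix_inv g *v x))"

section \<open>Spherical harmonics\<close>

definition monomial :: "('d \<Rightarrow> nat) \<Rightarrow> real^'d \<Rightarrow> complex" where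
  "monomial \<alpha> x = of_real (\<Prod>i\<in>UNIV. (x $ i) ^ \<alpha> i)"

definition homogeneous_polys :: "nat \<Rightarrow> (real^'d \<Rightarrow> complex) set" where
  "homogeneous_polys n = cfun_span {monomial \<alpha> |\<alpha>. (\<Sum>i\<in>UNIV. \<alpha> i) = n}"

definition partial_deriv :: "'d \<Rightarrow> (real^'d \<Rightarrow> complex) \<Rightarrow> (real^'d \<Rightarrow> complex)" where
  "partial_deriv i f x = vector_derivative (\<lambda>t. f (x + t *\<^sub>R axis i 1)) (at 0)"

definition laplacian :: "(real^'d \<Rightarrow> complex) \<Rightarrow> (real^'d \<Rightarrow> complex)" where
  "laplacian f x = (\<Sum>i\<in>UNIV. partial_deriv i (partial_deriv i f) x)"

text \<open>
  Functions on the sphere are functions on the ambient space that vanish off the sphere, so that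
  the spaces below are complex vector spaces of the correct finite dimension.
\<close>

definition sphere_restrict :: "(real^'d \<Rightarrow> complex) \<Rightarrow> (real^'d \<Rightarrow> complex)" where
  "sphere_restrict f = (\<lambda>x. if x \<in> sphere 0 1 then f x else 0)"

definition sph_harmonics :: "nat \<Rightarrow> (real^'d \<Rightarrow> complex) set" where
  "sph_harmonics n = {sphere_restrict p |p. p \<in> homogeneous_polys n \<and> (\<forall>x. laplacian p x = 0)}"

definition sph_polys :: "nat \<Rightarrow> (real^'d \<Rightarrow> complex) set" where
  "sph_polys N = {(\<lambda>x. \<Sum>n\<le>N. h n x) |h. \<forall>n\<le>N. h n \<in> sph_harmonics n}"

definition harmonic_onb ::
  "(real^'d) measure \<Rightarrow> (nat \<Rightarrow> 'k set) \<Rightarrow> (nat \<Rightarrow> 'k \<Rightarrow> real^'d \<Rightarrow> complex) \<Rightarrow> bool" where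
  "harmonic_onb \<omega> I Y \<longleftrightarrow>
     (\<forall>n. finite (I n) \<and> card (I n) = cfun_dim (sph_harmonics n :: (real^'d \<Rightarrow> complex) set) \<and>
        Y n ` I n \<subseteq> sph_harmonics n \<and>
        (\<forall>k\<in>I n. \<forall>m\<in>I n. L2_inner \<omega> (Y n k) (Y n m) = (if k = m then 1 else 0)) \<and>
        cfun_span (Y n ` I n) = sph_harmonics n)"

definition fourier ::
  "(real^'d) measure \<Rightarrow> (nat \<Rightarrow> 'k \<Rightarrow> real^'d \<Rightarrow> complex) \<Rightarrow> (real^'d \<Rightarrow> complex) \<Rightarrow> nat \<Rightarrow> 'k \<Rightarrow> complex"
  where "fourier \<omega> Y f n k = L2_inner \<omega> f (Y n k)"

section \<open>Matrix coefficients and quadrature on the rotation group\<close>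

definition matrix_coeff ::
  "(real^'d) measure \<Rightarrow> (nat \<Rightarrow> 'k \<Rightarrow> real^'d \<Rightarrow> complex) \<Rightarrow> nat \<Rightarrow> 'k \<Rightarrow> 'k \<Rightarrow> real^'d^'d \<Rightarrow> complex"
  where "matrix_coeff \<omega> Y n k m g = L2_inner \<omega> (rot_action g (Y n m)) (Y n k)"

definition coeff_space ::
  "(real^'d) measure \<Rightarrow> (nat \<Rightarrow> 'k set) \<Rightarrow> (nat \<Rightarrow> 'k \<Rightarrow> real^'d \<Rightarrow> complex) \<Rightarrow> nat \<Rightarrow>
    (real^'d^'d \<Rightarrow> complex) set" where
  "coeff_space \<omega> I Y N =
     cfun_span {matrix_coeff \<omega> Y n k m |n k m. n \<le> N \<and> k \<in> I n \<and> m \<in> I n}"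

definition quadrature_exact ::
  "(real^'d^'d) measure \<Rightarrow> (real^'d^'d \<Rightarrow> complex) set \<Rightarrow>
    nat \<Rightarrow> (nat \<Rightarrow> real) \<Rightarrow> (nat \<Rightarrow> real^'d^'d) \<Rightarrow> bool" where
  "quadrature_exact \<mu> V R w g \<longleftrightarrow>
     (\<forall>f1\<in>V. \<forall>f2\<in>V.
        (LINT h|\<mu>. f1 h * f2 h) = (\<Sum>r=1..R. of_real (w r) * f1 (g r) * f2 (g r)))"

section \<open>The rotated systems\<close>

text \<open>The system is the family \<open>\<X>\<close> indexed by the pairs \<open>(j, r)\<close> with \<open>1 \<le> r \<le> r\<^sub>j\<close>.\<close>

definition system_index :: "(nat \<Rightarrow> nat) \<Rightarrow> (nat \<times> nat) set" where
  "system_index R = (SIGMA j:UNIV. {1..R j})"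

definition rot_system ::
  "(nat \<Rightarrow> nat \<Rightarrow> real) \<Rightarrow> (nat \<Rightarrow> nat \<Rightarrow> real^'d^'d) \<Rightarrow> (nat \<Rightarrow> real^'d \<Rightarrow> complex) \<Rightarrow>
    nat \<times> nat \<Rightarrow> real^'d \<Rightarrow> complex" where
  "rot_system w g \<Psi> = (\<lambda>(j, r) x. of_real (sqrt (w j r)) * rot_action (g j r) (\<Psi> j) x)"

definition frame_generating ::
  "(real^'d) measure \<Rightarrow> (nat \<Rightarrow> nat) \<Rightarrow> (nat \<Rightarrow> nat \<Rightarrow> real) \<Rightarrow> (nat \<Rightarrow> nat \<Rightarrow> real^'d^'d) \<Rightarrow>
    (nat \<Rightarrow> real^'d \<Rightarrow> complex) \<Rightarrow> bool" where
  "frame_generating \<omega> R w g \<Psi> \<longleftrightarrow> is_frame \<omega> (system_index R) (rot_system w g \<Psi>)"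

definition sigma_coeff ::
  "(real^'d) measure \<Rightarrow> (nat \<Rightarrow> 'k set) \<Rightarrow> (nat \<Rightarrow> 'k \<Rightarrow> real^'d \<Rightarrow> complex) \<Rightarrow>
    (nat \<Rightarrow> real^'d \<Rightarrow> complex) \<Rightarrow> nat \<Rightarrow> real" where
  "sigma_coeff \<omega> I Y \<Psi> n =
     inverse (real (cfun_dim (sph_harmonics n :: (real^'d \<Rightarrow> complex) set))) *
     (\<Sum>j. \<Sum>k\<in>I n. (cmod (fourier \<omega> Y (\<Psi> j) n k))\<^sup>2)"

end

theory Submission
  imports Defs "HOL-Computational_Algebra.Polynomial"
begin

text \<open>
  For each level \<open>j\<close> the quadrature rule turns the block of the frame operator into the integral
  operator with kernel
  \<open>B(x, y) = \<integral> (T(h) \<Psi>\<^sup>j)(x) cnj ((T(h) \<Psi>\<^sup>j)(y)) d\<mu>(h)\<close>, which is invariant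
  under simultaneous rotation of \<open>x\<close> and \<open>y\<close>. Every invariant kernel acts on the harmonics of
  degree \<open>n\<close> as a scalar, because zonal harmonics of a given degree are unique up to a factor;
  taking the trace identifies the scalar as the \<open>j\<close>-th summand of \<open>\<sigma>\<^sub>n\<close>. Hence the frame
  operator multiplies the degree-\<open>n\<close> component of a polynomial by \<open>\<sigma>\<^sub>n\<close>, and it maps the
  rotated \<open>\<Psi>'\<close> to the rotated \<open>\<Psi>\<close>. Applied to the projection kernels of the spaces of
  harmonics, the same principle also gives orthogonality of different degrees.
\<close>

section \<open>Rotations\<close>

text \<open>The symmetry of the kernel shapes the argument: any two pairs of points with equal norms
  and equal inner product must be matched by a genuine rotation. Orthogonal maps do this in every
  dimension; repairing the determinant costs a direction orthogonal to both points, which exists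
  because d \<ge> 3. Uniqueness of zonal harmonics uses d \<ge> 3 again, through a factor d - 2 in a
  recurrence.

  Spherical harmonics are restrictions, so their degree has to be recovered from values on the
  sphere. This is done by the eigenvalue n (n + d - 2) of the spherical Laplacian, evaluated at a
  single pole by differentiating along great circles and moved to other points by rotations.

  The frame operator is never inverted. The functions of the dual system are polynomials, so it
  suffices to apply the operator to finite sums of harmonics, and the lower frame bound makes
  preimages unique almost everywhere. Only complete levels act as scalars, whereas convergence is
  demanded along all finite sets of indices; the Bessel bound closes this gap.\<close>

lemma reflection_exists:
  fixes a b :: "'a::euclidean_space"
  assumes "norm a = norm b"
  shows "\<exists>f. orthogonal_transformation f \<and> f a = b \<and> (\<forall>v. v \<bullet> (a - b) = 0 \<longrightarrow> f v = v)"
proof (cases "a = b")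
  case True
  then show ?thesis by (intro exI[of _ "\<lambda>x. x"]) auto
next
  case False
  define n where "n = a - b"
  \<comment> \<open>The Householder reflection along a - b. Its fixed vectors are recorded in the
    claim so that a second reflection can be applied without disturbing the image of an earlier
    one.\<close>
  define f where "f v = v - (2 * (v \<bullet> n) / (n \<bullet> n)) *\<^sub>R n" for v
  have nn: "n \<bullet> n \<noteq> 0" using False by (simp add: n_def)
  have lin: "linear f"
    by (rule linearI) (simp_all add: f_def inner_add_left algebra_simps add_divide_distrib)
  have inn: "f v \<bullet> f w = v \<bullet> w" for v w
    using nn by (simp add: f_def inner_diff_left inner_diff_right field_simps inner_commute)
  have "a \<bullet> a = b \<bullet> b" using assms by (simp add: norm_eq)
  then have "n \<bullet> n = 2 * (a \<bullet> n)"
    by (simp add: n_def inner_diff_left inner_diff_right inner_commute)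
  then have "2 * (a \<bullet> n) / (n \<bullet> n) = 1" using nn by (metis divide_self)
  then have "f a = a - 1 *\<^sub>R n" by (simp only: f_def)
  then have "f a = b" by (simp add: n_def)
  then show ?thesis using lin inn
    by (intro exI[of _ f]) (auto simp: orthogonal_transformation_def f_def n_def)
qed

text \<open>Conjugating the reflection that flips one coordinate by a rotation taking that axis to
  \<open>n\<close> keeps the determinant -1 and moves the mirror to the hyperplane orthogonal to
  \<open>n\<close>.\<close>

lemma matrix_reflection_exists:
  fixes n :: "real^'d"
  assumes "CARD('d) \<ge> 2" "norm n = 1"
  shows "\<exists>D. orthogonal_matrix D \<and> det D = -1 \<and> (\<forall>v. v \<bullet> n = 0 \<longrightarrow> D *v v = v)"
proof -
  fix k :: 'd
  obtain A where A: "rotation_matrix A" "A *v axis k 1 = n"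
    using rotation_matrix_exists_basis assms by metis
  define S :: "real^'d^'d" where "S = (\<chi> i j. if i = j then (if i = k then -1 else 1) else 0)"
  have trS: "transpose S = S" by (auto simp: S_def transpose_def vec_eq_iff)
  have SS: "S ** S = mat 1"
    by (auto simp: S_def matrix_matrix_mult_def mat_def vec_eq_iff if_distrib[of "\<lambda>x. x * _"]
        cong: if_cong)
  have "det S = (\<Prod>i\<in>UNIV. if i = k then -1 else (1::real))"
    by (subst det_diagonal) (auto simp: S_def)
  then have dS: "det S = -1" by (simp add: prod.delta)
  have oA: "A ** transpose A = mat 1" "transpose A ** A = mat 1" "det A = 1"
    using A(1) by (auto simp: rotation_matrix_def orthogonal_matrix_def)
  define D where "D = A ** S ** transpose A"
  have oD: "orthogonal_matrix D"
    unfolding D_def using A(1) SS trS oA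
    by (intro orthogonal_matrix_mul) (auto simp: rotation_matrix_def orthogonal_matrix_def)
  have "det D = -1" by (simp add: D_def det_mul dS oA)
  moreover have "D *v v = v" if "v \<bullet> n = 0" for v
  proof -
    define u where "u = transpose A *v v"
    have "u $ k = u \<bullet> axis k 1" by (simp add: inner_axis)
    also have "\<dots> = v \<bullet> (A *v axis k 1)"
      by (simp add: u_def dot_lmul_matrix)
    finally have "u $ k = 0" using that A by simp
    then have "S *v u = u"
      by (auto simp: S_def matrix_vector_mult_def vec_eq_iff if_distrib[of "\<lambda>x. x * _"] cong: if_cong)
    then have "D *v v = A *v u"
      by (simp add: D_def u_def matrix_vector_mul_assoc[symmetric] del: matrix_vector_mul_assoc)
    also have "\<dots> = v" by (simp only: u_def matrix_vector_mul_assoc oA matrix_vector_mul_lid)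
    finally show ?thesis .
  qed
  ultimately show ?thesis using oD by blast
qed

text \<open>Two reflections place \<open>x\<close> and then \<open>z\<close>. If their product has
  determinant -1, composing with the reflection along a direction orthogonal to both
  \<open>x'\<close> and \<open>z'\<close> repairs it without moving either image; in three or more
  dimensions such a direction exists.\<close>

lemma SO_maps_pair:
  fixes x z x' z' :: "real^'d"
  assumes d: "CARD('d) \<ge> 3"
    and "norm x = norm x'" "norm z = norm z'" "x \<bullet> z = x' \<bullet> z'"
  shows "\<exists>h\<in>SO. h *v x = x' \<and> h *v z = z'"
proof -
  obtain f where f: "orthogonal_transformation f" "f x = x'"
    using reflection_exists[OF assms(2)] by blast
  have "norm (f z) = norm z'" using f(1) assms(3) by (simp add: orthogonal_transformation_norm)
  then obtain f' where f': "orthogonal_transformation f'" "f' (f z) = z'"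
      "\<And>v. v \<bullet> (f z - z') = 0 \<Longrightarrow> f' v = v"
    using reflection_exists by blast
  \<comment> \<open>Equality of the inner products makes \<open>x'\<close> orthogonal to
    \<open>f z - z'\<close>, so the second reflection fixes it.\<close>
  have "x' \<bullet> f z = x' \<bullet> z'"
    using f assms(4) by (metis orthogonal_transformation_def)
  then have "f' x' = x'" by (intro f'(3)) (simp add: inner_diff_right)
  define O' where "O' = matrix (f' \<circ> f)"
  have ot: "orthogonal_transformation (f' \<circ> f)"
    using f f' by (intro orthogonal_transformation_compose)
  then have lin: "linear (f' \<circ> f)" by (rule orthogonal_transformation_linear)
  have O: "orthogonal_matrix O'" "O' *v x = x'" "O' *v z = z'"
    using ot f f' lin \<open>f' x' = x'\<close>
    by (auto simp: O'_def matrix_works orthogonal_transformation_matrix)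
  consider "det O' = 1" | "det O' = -1" using det_orthogonal_matrix[OF O(1)] by blast
  then show ?thesis
  proof cases
    case 1
    then show ?thesis using O by (auto simp: SO_def rotation_matrix_def)
  next
    case 2
    have "dim {x', z'} \<le> card {x', z'}" by (rule dim_le_card') simp
    also have "\<dots> \<le> 2" by (rule card_2_iff'[THEN iffD2, THEN eq_imp_le] card_insert_le_m1)+ auto
    also have "\<dots> < DIM(real^'d)" using d by simp
    finally obtain n where n: "n \<noteq> 0" "\<And>y. y \<in> span {x', z'} \<Longrightarrow> orthogonal n y"
      using orthogonal_to_subspace_exists by metis
    obtain D where D: "orthogonal_matrix D" "det D = -1"
        "\<And>v. v \<bullet> (n /\<^sub>R norm n) = 0 \<Longrightarrow> D *v v = v"
      using matrix_reflection_exists[of "n /\<^sub>R norm n"] d n(1) by auto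
    have "D *v x' = x'" "D *v z' = z'"
      using n(2)[of x'] n(2)[of z'] by (auto intro!: D(3) simp: span_base orthogonal_def inner_commute)
    then show ?thesis using O D 2
      by (intro bexI[of _ "D ** O'"])
        (auto simp: SO_def rotation_matrix_def orthogonal_matrix_mul det_mul
          simp flip: matrix_vector_mul_assoc)
  qed
qed

lemma SO_matrix_inv:
  assumes "h \<in> SO"
  shows "matrix_inv h = transpose h" "matrix_inv h \<in> SO"
    "matrix_inv h ** h = mat 1" "h ** matrix_inv h = mat 1"
proof -
  have o: "transpose h ** h = mat 1" "h ** transpose h = mat 1"
    using assms by (auto simp: SO_def rotation_matrix_def orthogonal_matrix_def)
  then show inv: "matrix_inv h ** h = mat 1" "h ** matrix_inv h = mat 1"
    unfolding matrix_inv_def by (metis (mono_tags, lifting) someI_ex)+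
  then show "matrix_inv h = transpose h"
    using o by (metis matrix_mul_assoc matrix_mul_lid matrix_mul_rid)
  then show "matrix_inv h \<in> SO" using assms by (auto simp: SO_def rotation_matrix_def)
qed

lemma SO_mult: "h \<in> SO \<Longrightarrow> k \<in> SO \<Longrightarrow> h ** k \<in> SO"
  by (auto simp: SO_def rotation_matrix_def orthogonal_matrix_mul det_mul)

lemma SO_norm [simp]: "h \<in> SO \<Longrightarrow> norm (h *v x) = norm x"
  by (metis SO_def mem_Collect_eq orthogonal_transformation_matrix orthogonal_transformation_norm
      matrix_vector_mul_linear matrix_of_matrix_vector_mul rotation_matrix_def)

lemma SO_matrix_inv_mult [simp]:
  assumes "h \<in> SO"
  shows "matrix_inv h *v (h *v x) = x" "h *v (matrix_inv h *v x) = x"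
  using SO_matrix_inv(3,4)[OF assms] by (simp_all add: matrix_vector_mul_assoc)

lemma SO_matrix_inv_inv: "h \<in> SO \<Longrightarrow> matrix_inv (matrix_inv h) = h"
  by (metis SO_matrix_inv(1,2) transpose_transpose)

lemma SO_matrix_inv_prod:
  assumes "h \<in> SO" "k \<in> SO"
  shows "matrix_inv (h ** k) = matrix_inv k ** matrix_inv h"
  using assms by (simp add: SO_matrix_inv(1) SO_mult matrix_transpose_mul)

section \<open>Polynomial functions\<close>

lemma cfun_subspaceI:
  assumes "(\<lambda>x. 0) \<in> T" "\<And>f g. f \<in> T \<Longrightarrow> g \<in> T \<Longrightarrow> (\<lambda>x. f x + g x) \<in> T"
    "\<And>c f. f \<in> T \<Longrightarrow> (\<lambda>x. c * f x) \<in> T"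
  shows "cfun.subspace T"
  using assms by (simp add: cfun.subspace_def zero_fun_def plus_fun_def)

lemma cfun_span_add: "f \<in> cfun_span S \<Longrightarrow> g \<in> cfun_span S \<Longrightarrow> (\<lambda>x. f x + g x) \<in> cfun_span S"
  using cfun.span_add[of f S g] by (simp add: plus_fun_def)

lemma cfun_span_zero: "(\<lambda>x. 0) \<in> cfun_span S"
  using cfun.span_zero[of S] by (simp add: zero_fun_def)

lemma cfun_span_sum:
  assumes "\<And>a. a \<in> A \<Longrightarrow> f a \<in> cfun_span S"
  shows "(\<lambda>x. \<Sum>a\<in>A. f a x) \<in> cfun_span S"
  using assms by (induction A rule: infinite_finite_induct) (auto intro: cfun_span_add cfun_span_zero)

text \<open>Polynomial functions without a degree. With products as a generating rule,
  differentiability and linear substitution follow by induction with no bookkeeping of exponents;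
  the graded spaces are linked to it by \<open>homogeneous_polyfun\<close>.\<close>

inductive_set polyfun :: "(real^'d \<Rightarrow> complex) set" where
  const: "(\<lambda>x. c) \<in> polyfun"
| coord: "(\<lambda>x. of_real (x $ i)) \<in> polyfun"
| add: "p \<in> polyfun \<Longrightarrow> q \<in> polyfun \<Longrightarrow> (\<lambda>x. p x + q x) \<in> polyfun"
| mult: "p \<in> polyfun \<Longrightarrow> q \<in> polyfun \<Longrightarrow> (\<lambda>x. p x * q x) \<in> polyfun"

lemma polyfun_sum: "(\<And>a. a \<in> A \<Longrightarrow> f a \<in> polyfun) \<Longrightarrow> (\<lambda>x. \<Sum>a\<in>A. f a x) \<in> polyfun"
  by (induction A rule: infinite_finite_induct) (auto intro: polyfun.intros)

lemma polyfun_prod: "(\<And>a. a \<in> A \<Longrightarrow> f a \<in> polyfun) \<Longrightarrow> (\<lambda>x. \<Prod>a\<in>A. f a x) \<in> polyfun"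
  by (induction A rule: infinite_finite_induct) (auto intro: polyfun.intros)

lemma polyfun_power: "p \<in> polyfun \<Longrightarrow> (\<lambda>x. p x ^ k) \<in> polyfun"
  by (induction k) (auto intro: polyfun.intros)

section \<open>Differential calculus of polynomial functions\<close>

lemma polyfun_derivative_exists:
  assumes "p \<in> polyfun"
  shows "\<exists>D. (\<forall>i. D i \<in> polyfun) \<and> (\<forall>x. (p has_derivative (\<lambda>v. \<Sum>i\<in>UNIV. v $ i *\<^sub>R D i x)) (at x))"
  using assms
proof induction
  case (const c)
  show ?case by (rule exI[of _ "\<lambda>i x. 0"]) (auto intro: polyfun.const)
next
  case (coord k)
  have "((\<lambda>x. of_real (x $ k) :: complex) has_derivative (\<lambda>v. \<Sum>i\<in>UNIV. v $ i *\<^sub>R (if i = k then 1 else 0))) (at x)"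
    for x :: "real^'a"
  proof -
    have "((\<lambda>x. of_real (x $ k)::complex) has_derivative (\<lambda>v. of_real (v $ k))) (at x)"
      by (intro bounded_linear_imp_has_derivative
          bounded_linear_compose[OF bounded_linear_of_real bounded_linear_vec_nth])
    moreover have "(\<Sum>i\<in>UNIV. v $ i *\<^sub>R (if i = k then 1 else 0)) = (of_real (v $ k)::complex)" for v :: "real^'a"
      by (simp add: if_distrib[of "\<lambda>y. _ * y"] scaleR_conv_of_real cong: if_cong)
    ultimately show ?thesis by simp
  qed
  then show ?case
    by (intro exI[of _ "\<lambda>i x. if i = k then 1 else 0"]) (auto intro: polyfun.const)
next
  case (add p q)
  then obtain D E where "\<forall>i. D i \<in> polyfun" "\<forall>i. E i \<in> polyfun"
    and 1: "\<And>x. (p has_derivative (\<lambda>v. \<Sum>i\<in>UNIV. v $ i *\<^sub>R D i x)) (at x)"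
      "\<And>x. (q has_derivative (\<lambda>v. \<Sum>i\<in>UNIV. v $ i *\<^sub>R E i x)) (at x)"
    by auto
  then show ?case
    by (intro exI[of _ "\<lambda>i x. D i x + E i x"] conjI allI has_derivative_eq_rhs[OF has_derivative_add[OF 1]])
      (auto intro: polyfun.intros simp: scaleR_right_distrib sum.distrib)
next
  case (mult p q)
  then obtain D E where DE: "\<And>i. D i \<in> polyfun" "\<And>i. E i \<in> polyfun"
    and 1: "\<And>x. (p has_derivative (\<lambda>v. \<Sum>i\<in>UNIV. v $ i *\<^sub>R D i x)) (at x)"
      "\<And>x. (q has_derivative (\<lambda>v. \<Sum>i\<in>UNIV. v $ i *\<^sub>R E i x)) (at x)"
    by auto
  have "(\<lambda>x. p x * E i x + D i x * q x) \<in> polyfun" for i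
    by (intro polyfun.intros DE mult.hyps)
  then show ?case
    by (intro exI[of _ "\<lambda>i x. p x * E i x + D i x * q x"] conjI allI
        has_derivative_eq_rhs[OF has_derivative_mult[OF 1]])
      (simp_all add: scaleR_right_distrib sum.distrib sum_distrib_left sum_distrib_right)
qed

text \<open>\<open>partial_deriv\<close> is defined through \<open>vector_derivative\<close>, which
  says nothing until a derivative is known to exist. The chain rule along an axis identifies it with
  the coefficient of the total derivative, so differentiation stays within \<open>polyfun\<close>
  and can be iterated.\<close>

lemma
  fixes p :: "real^'d \<Rightarrow> complex"
  assumes "p \<in> polyfun"
  shows polyfun_partial_deriv: "partial_deriv i p \<in> polyfun"
    and polyfun_has_derivative:
      "(p has_derivative (\<lambda>v. \<Sum>i\<in>UNIV. v $ i *\<^sub>R partial_deriv i p x)) (at x)"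
proof -
  obtain D where D: "\<And>i. D i \<in> polyfun"
    and der: "\<And>x. (p has_derivative (\<lambda>v. \<Sum>i\<in>UNIV. v $ i *\<^sub>R D i x)) (at x)"
    using polyfun_derivative_exists[OF assms] by blast
  have eq: "partial_deriv i p = D i" for i
  proof
    fix x
    have *: "((\<lambda>t. x + t *\<^sub>R axis i 1) has_vector_derivative (axis i 1 :: real^'d)) (at 0)"
      by (auto intro!: derivative_eq_intros)
    have "((p \<circ> (\<lambda>t. x + t *\<^sub>R axis i 1)) has_vector_derivative
        (\<Sum>j\<in>UNIV. (axis i 1 :: real^'d) $ j *\<^sub>R D j x)) (at 0)"
      using vector_derivative_diff_chain_within[OF *, of p "\<lambda>v. \<Sum>i\<in>UNIV. v $ i *\<^sub>R D i x"] der[of x]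
      by (simp add: has_derivative_at_withinI)
    moreover have "(\<Sum>j\<in>UNIV. (axis i 1 :: real^'d) $ j *\<^sub>R D j x) = D i x"
      by (simp add: axis_def if_distrib[of "\<lambda>y. y *\<^sub>R _"] cong: if_cong)
    ultimately show "partial_deriv i p x = D i x"
      by (simp add: partial_deriv_def o_def vector_derivative_at)
  qed
  show "partial_deriv i p \<in> polyfun" by (simp add: eq D)
  show "(p has_derivative (\<lambda>v. \<Sum>i\<in>UNIV. v $ i *\<^sub>R partial_deriv i p x)) (at x)"
    by (simp add: eq der)
qed

lemma polyfun_continuous: "p \<in> polyfun \<Longrightarrow> continuous_on S p"
  by (meson continuous_at_imp_continuous_on has_derivative_continuous polyfun_has_derivative)

lemma polyfun_along_path:
  assumes "p \<in> polyfun" "(c has_vector_derivative c') (at u)"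
  shows "((\<lambda>u. p (c u)) has_vector_derivative (\<Sum>i\<in>UNIV. c' $ i *\<^sub>R partial_deriv i p (c u))) (at u)"
  using vector_derivative_diff_chain_within[OF assms(2)
      has_derivative_at_withinI[OF polyfun_has_derivative[OF assms(1)]]]
  by (simp add: o_def)

lemma partial_deriv_along_line:
  assumes "p \<in> polyfun"
  shows "((\<lambda>t. p (x + t *\<^sub>R axis i 1)) has_vector_derivative partial_deriv i p x) (at 0)"
proof -
  have *: "((\<lambda>t. x + t *\<^sub>R axis i 1) has_vector_derivative axis i 1) (at 0)"
    by (auto intro!: derivative_eq_intros)
  show ?thesis
    using polyfun_along_path[OF assms *]
    by (simp add: axis_def if_distrib[of "\<lambda>y. y *\<^sub>R _"] cong: if_cong)
qed

lemma partial_deriv_eqI: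
  "((\<lambda>t. p (x + t *\<^sub>R axis i 1)) has_vector_derivative D) (at 0) \<Longrightarrow> partial_deriv i p x = D"
  by (simp add: partial_deriv_def vector_derivative_at)

lemma partial_deriv_sum:
  assumes "\<And>a. a \<in> A \<Longrightarrow> f a \<in> polyfun"
  shows "partial_deriv i (\<lambda>x. \<Sum>a\<in>A. c a *\<^sub>R f a x) x = (\<Sum>a\<in>A. c a *\<^sub>R partial_deriv i (f a) x)"
  by (intro partial_deriv_eqI)
    (auto intro!: derivative_eq_intros partial_deriv_along_line assms)

lemma partial_deriv_cnj:
  assumes "p \<in> polyfun"
  shows "partial_deriv i (\<lambda>x. cnj (p x)) = (\<lambda>x. cnj (partial_deriv i p x))"
  by (intro ext partial_deriv_eqI has_vector_derivative_cnj partial_deriv_along_line assms)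

lemma polyfun_matrix:
  assumes "p \<in> polyfun"
  shows "(\<lambda>x. p (A *v x)) \<in> polyfun"
  using assms
proof induction
  case (coord i)
  have "(\<lambda>x. \<Sum>j\<in>UNIV. of_real (A $ i $ j) * of_real (x $ j)) \<in> polyfun"
    by (intro polyfun_sum polyfun.intros)
  then show ?case by (simp add: matrix_vector_mult_def)
qed (auto intro: polyfun.intros)

lemma partial_deriv_matrix:
  assumes "p \<in> polyfun"
  shows "partial_deriv i (\<lambda>x. p (A *v x)) = (\<lambda>x. \<Sum>j\<in>UNIV. A $ j $ i *\<^sub>R partial_deriv j p (A *v x))"
proof
  fix x
  have *: "((\<lambda>t. A *v (x + t *\<^sub>R axis i 1)) has_vector_derivative A *v axis i 1) (at 0)"
    by (rule bounded_linear.has_vector_derivative[OF matrix_vector_mul_bounded_linear])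
      (auto intro!: derivative_eq_intros)
  have "((\<lambda>t. p (A *v (x + t *\<^sub>R axis i 1))) has_vector_derivative
      (\<Sum>j\<in>UNIV. (A *v axis i 1) $ j *\<^sub>R partial_deriv j p (A *v x))) (at 0)"
    using polyfun_along_path[OF assms *] by simp
  then show "partial_deriv i (\<lambda>x. p (A *v x)) x = (\<Sum>j\<in>UNIV. A $ j $ i *\<^sub>R partial_deriv j p (A *v x))"
    by (intro partial_deriv_eqI) (simp add: matrix_vector_mul_component inner_axis)
qed

text \<open>The chain rule produces the Hessian conjugated by \<open>A\<close>; orthonormality of
  the rows of \<open>A\<close> reduces its trace to that of the Hessian itself.\<close>

lemma laplacian_rotation:
  assumes p: "p \<in> polyfun" and A: "A ** transpose A = mat 1"
  shows "laplacian (\<lambda>x. p (A *v x)) x = laplacian p (A *v x)"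
proof -
  have AA: "(\<Sum>i\<in>UNIV. A $ j $ i * A $ k $ i) = (if j = k then 1 else 0)" for j k
    using A by (simp add: matrix_matrix_mult_def transpose_def mat_def vec_eq_iff)
  have "partial_deriv i (partial_deriv i (\<lambda>x. p (A *v x))) x =
      (\<Sum>j\<in>UNIV. A $ j $ i *\<^sub>R (\<Sum>k\<in>UNIV. A $ k $ i *\<^sub>R partial_deriv k (partial_deriv j p) (A *v x)))" for i
    by (simp add: partial_deriv_matrix p polyfun_partial_deriv partial_deriv_sum polyfun_matrix)
  then have "laplacian (\<lambda>x. p (A *v x)) x = (\<Sum>i\<in>UNIV. \<Sum>j\<in>UNIV. \<Sum>k\<in>UNIV.
      (A $ j $ i * A $ k $ i) *\<^sub>R partial_deriv k (partial_deriv j p) (A *v x))"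
    by (simp add: laplacian_def scaleR_sum_right)
  also have "\<dots> = (\<Sum>j\<in>UNIV. \<Sum>k\<in>UNIV. \<Sum>i\<in>UNIV.
      (A $ j $ i * A $ k $ i) *\<^sub>R partial_deriv k (partial_deriv j p) (A *v x))"
    by (subst sum.swap) (intro sum.cong refl sum.swap)
  also have "\<dots> = laplacian p (A *v x)"
    by (simp add: laplacian_def flip: scaleR_sum_left)
      (simp add: AA if_distrib[of "\<lambda>y. y *\<^sub>R _"] cong: if_cong)
  finally show ?thesis .
qed

lemma laplacian_cnj:
  assumes "p \<in> polyfun"
  shows "laplacian (\<lambda>x. cnj (p x)) x = cnj (laplacian p x)"
  by (simp add: laplacian_def partial_deriv_cnj assms polyfun_partial_deriv)

text \<open>Both sides are the second derivative at u = 0 along the circle: the velocity there is s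
  times the \<open>j\<close>-th axis vector and the acceleration is -s times the
  \<open>i\<close>-th. This combination of ambient derivatives therefore depends only on values on
  the circle. Great circles (\<open>a\<close> = 0) and circles around a coordinate axis are both
  used later.\<close>

lemma second_deriv_along_circle:
  fixes p q :: "real^'d \<Rightarrow> complex"
  assumes pq: "p \<in> polyfun" "q \<in> polyfun"
    and eq: "\<And>u. p (a + (s * cos u) *\<^sub>R axis i 1 + (s * sin u) *\<^sub>R axis j 1) =
      q (a + (s * cos u) *\<^sub>R axis i 1 + (s * sin u) *\<^sub>R axis j 1)"
  defines "x \<equiv> a + s *\<^sub>R axis i 1"
  shows "s\<^sup>2 *\<^sub>R partial_deriv j (partial_deriv j p) x - s *\<^sub>R partial_deriv i p x =
    s\<^sup>2 *\<^sub>R partial_deriv j (partial_deriv j q) x - s *\<^sub>R partial_deriv i q x"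
proof -
  define c where "c u = a + (s * cos u) *\<^sub>R axis i 1 + (s * sin u) *\<^sub>R axis j (1::real)" for u
  define F where "F f u = (- s * sin u) *\<^sub>R partial_deriv i f (c u) + (s * cos u) *\<^sub>R partial_deriv j f (c u)"
    for f u
  have c': "(c has_vector_derivative ((- s * sin u) *\<^sub>R axis i 1 + (s * cos u) *\<^sub>R axis j 1)) (at u)" for u
    unfolding c_def by (auto intro!: derivative_eq_intros simp: mult.commute)
  have d1: "((\<lambda>u. f (c u)) has_vector_derivative F f u) (at u)" if "f \<in> polyfun" for f u
    using polyfun_along_path[OF that c'[of u]]
    by (simp add: F_def axis_def scaleR_left_diff_distrib sum_subtractf if_distrib[of "\<lambda>y. y *\<^sub>R _"]
        if_distrib[of "\<lambda>y. _ * y"] cong: if_cong)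
  have d2: "(F f has_vector_derivative
      s\<^sup>2 *\<^sub>R partial_deriv j (partial_deriv j f) x - s *\<^sub>R partial_deriv i f x) (at 0)"
    if f: "f \<in> polyfun" for f
  proof -
    have c0: "c 0 = x" by (simp add: c_def x_def)
    have "((\<lambda>u. (- s * sin u) *\<^sub>R partial_deriv i f (c u) + (s * cos u) *\<^sub>R partial_deriv j f (c u))
       has_vector_derivative
        ((- s * sin 0) *\<^sub>R F (partial_deriv i f) 0 + (- s * cos 0) *\<^sub>R partial_deriv i f (c 0)) +
        ((s * cos 0) *\<^sub>R F (partial_deriv j f) 0 + (s * - sin 0) *\<^sub>R partial_deriv j f (c 0))) (at 0)"
      by (intro has_vector_derivative_add has_vector_derivative_scaleR d1 polyfun_partial_deriv f)
        (auto intro!: derivative_eq_intros)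
    then show ?thesis
      unfolding F_def[of f, abs_def] by (simp add: c0 F_def power2_eq_square)
  qed
  have "F p u = F q u" for u
    using d1[OF pq(1), of u] d1[OF pq(2), of u] eq
    by (auto simp: c_def intro: vector_derivative_unique_at)
  then have "F p = F q" by auto
  then show ?thesis using d2[OF pq(1)] d2[OF pq(2)] vector_derivative_unique_at by metis
qed

section \<open>Homogeneous harmonic polynomials\<close>

lemma homogeneous_polys_closed:
  shows homogeneous_polys_zero: "(\<lambda>x. 0) \<in> homogeneous_polys n"
    and homogeneous_polys_add: "p \<in> homogeneous_polys n \<Longrightarrow> q \<in> homogeneous_polys n \<Longrightarrow> (\<lambda>x. p x + q x) \<in> homogeneous_polys n"
    and homogeneous_polys_cmult: "p \<in> homogeneous_polys n \<Longrightarrow> (\<lambda>x. c * p x) \<in> homogeneous_polys n"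
  unfolding homogeneous_polys_def
  by (auto intro: cfun_span_zero cfun_span_add cfun.span_scale)

lemma monomial_homogeneous: "(\<Sum>i\<in>UNIV. \<alpha> i) = n \<Longrightarrow> monomial \<alpha> \<in> homogeneous_polys n"
  unfolding homogeneous_polys_def by (intro cfun.span_base) auto

lemma homogeneous_polys_induct [consumes 1, case_names zero add cmult monomial]:
  assumes "p \<in> homogeneous_polys n"
    and "P (\<lambda>x. 0)" "\<And>p q. P p \<Longrightarrow> P q \<Longrightarrow> P (\<lambda>x. p x + q x)" "\<And>c p. P p \<Longrightarrow> P (\<lambda>x. c * p x)"
    and mon: "\<And>\<alpha>. (\<Sum>i\<in>UNIV. \<alpha> i) = n \<Longrightarrow> P (monomial \<alpha>)"
  shows "P p"
proof -
  have "cfun.subspace {p. P p}" using assms(2-4) by (intro cfun_subspaceI) auto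
  then have "homogeneous_polys n \<subseteq> {p. P p}"
    unfolding homogeneous_polys_def by (intro cfun.span_minimal) (auto intro: mon)
  then show ?thesis using assms(1) by auto
qed

lemma homogeneous_polyfun: "p \<in> homogeneous_polys n \<Longrightarrow> p \<in> polyfun"
proof (induction rule: homogeneous_polys_induct)
  case (monomial \<alpha>)
  show ?case unfolding monomial_def of_real_prod of_real_power
    by (intro polyfun_prod polyfun_power polyfun.intros)
qed (auto intro: polyfun.intros)

lemma homogeneous_scaleR: "p \<in> homogeneous_polys n \<Longrightarrow> p (c *\<^sub>R x) = of_real (c ^ n) * p x"
proof (induction rule: homogeneous_polys_induct)
  case (monomial \<alpha>)
  then show ?case
    by (simp add: monomial_def power_mult_distrib prod.distrib flip: power_sum)
qed (auto simp: algebra_simps)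

lemma homogeneous_cnj: "p \<in> homogeneous_polys n \<Longrightarrow> (\<lambda>x. cnj (p x)) \<in> homogeneous_polys n"
proof (induction rule: homogeneous_polys_induct)
  case (monomial \<alpha>)
  then show ?case using monomial_homogeneous[OF monomial] by (simp add: monomial_def[abs_def])
qed (auto intro: homogeneous_polys_closed)

lemma homogeneous_mult:
  assumes "p \<in> homogeneous_polys m" "q \<in> homogeneous_polys n"
  shows "(\<lambda>x. p x * q x) \<in> homogeneous_polys (m + n)"
  using assms(1)
proof (induction rule: homogeneous_polys_induct)
  case (monomial \<alpha>)
  show ?case using assms(2)
  proof (induction rule: homogeneous_polys_induct)
    case (monomial \<beta>)
    have "monomial (\<lambda>i. \<alpha> i + \<beta> i) \<in> homogeneous_polys (m + n)"
      using monomial \<open>sum \<alpha> UNIV = m\<close> by (intro monomial_homogeneous) (simp add: sum.distrib)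
    then show ?case by (simp add: monomial_def[abs_def] power_add prod.distrib)
  next
    case (cmult c p)
    then have "(\<lambda>x. c * (monomial \<alpha> x * p x)) \<in> homogeneous_polys (m + n)"
      by (intro homogeneous_polys_closed)
    then show ?case by (simp add: mult_ac)
  qed (auto intro: homogeneous_polys_closed simp: distrib_left)
qed (auto intro: homogeneous_polys_closed simp: distrib_right mult.assoc)

lemma homogeneous_one: "(\<lambda>x. 1) \<in> homogeneous_polys 0"
  using monomial_homogeneous[of "\<lambda>i. 0" 0] by (simp add: monomial_def[abs_def])

lemma homogeneous_power: "p \<in> homogeneous_polys m \<Longrightarrow> (\<lambda>x. p x ^ k) \<in> homogeneous_polys (k * m)"
  by (induction k) (auto intro: homogeneous_one homogeneous_mult)

lemma homogeneous_prod:
  assumes "finite A" "\<And>a. a \<in> A \<Longrightarrow> f a \<in> homogeneous_polys (m a)"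
  shows "(\<lambda>x. \<Prod>a\<in>A. f a x) \<in> homogeneous_polys (\<Sum>a\<in>A. m a)"
  using assms by (induction A) (auto intro: homogeneous_one homogeneous_mult)

lemma homogeneous_linear:
  fixes A :: "real^'d^'d"
  shows "(\<lambda>x. of_real ((A *v x) $ i)) \<in> homogeneous_polys 1"
proof -
  have "(\<lambda>x. of_real (x $ j)) \<in> homogeneous_polys 1" for j :: 'd
  proof -
    have "monomial (\<lambda>i. if i = j then 1 else 0) = (\<lambda>x. of_real (x $ j))"
      by (simp add: monomial_def[abs_def] if_distrib[of "\<lambda>y. _ ^ y"] cong: if_cong)
    then show ?thesis using monomial_homogeneous[of "\<lambda>i. if i = j then 1 else 0" 1] by simp
  qed
  then have "(\<lambda>x. \<Sum>j\<in>UNIV. of_real (A $ i $ j) * of_real (x $ j)) \<in> homogeneous_polys 1"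
    unfolding homogeneous_polys_def by (intro cfun_span_sum cfun.span_scale)
  then show ?thesis by (simp add: matrix_vector_mult_def)
qed

lemma homogeneous_matrix:
  fixes A :: "real^'d^'d"
  shows "p \<in> homogeneous_polys n \<Longrightarrow> (\<lambda>x. p (A *v x)) \<in> homogeneous_polys n"
proof (induction rule: homogeneous_polys_induct)
  case (monomial \<alpha>)
  have "(\<lambda>x. \<Prod>i\<in>UNIV. of_real ((A *v x) $ i) ^ \<alpha> i) \<in> homogeneous_polys (\<Sum>i\<in>UNIV. \<alpha> i * 1)"
    by (intro homogeneous_prod homogeneous_power homogeneous_linear) (rule finite)
  then show ?case using monomial by (simp add: monomial_def)
qed (auto intro: homogeneous_polys_closed)

section \<open>Harmonic polynomials on coordinate planes and at the poles\<close>

lemma homogeneous_plane_expansion: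
  fixes p :: "real^'d \<Rightarrow> complex"
  assumes "p \<in> homogeneous_polys n" "i \<noteq> j"
  obtains a where "\<And>t s. p (t *\<^sub>R axis i 1 + s *\<^sub>R axis j 1) = (\<Sum>m\<le>n. a m * of_real (t ^ (n - m) * s ^ m))"
proof -
  have "\<exists>a. \<forall>t s. p (t *\<^sub>R axis i 1 + s *\<^sub>R axis j 1) = (\<Sum>m\<le>n. a m * of_real (t ^ (n - m) * s ^ m))"
    using assms(1)
  proof (induction rule: homogeneous_polys_induct)
    case zero
    then show ?case by (intro exI[of _ "\<lambda>_. 0"]) auto
  next
    case (add p q)
    then obtain a b where "\<forall>t s. p (t *\<^sub>R axis i 1 + s *\<^sub>R axis j 1) = (\<Sum>m\<le>n. a m * of_real (t ^ (n - m) * s ^ m))"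
      "\<forall>t s. q (t *\<^sub>R axis i 1 + s *\<^sub>R axis j 1) = (\<Sum>m\<le>n. b m * of_real (t ^ (n - m) * s ^ m))"
      by blast
    then show ?case by (intro exI[of _ "\<lambda>m. a m + b m"]) (simp add: sum.distrib distrib_right)
  next
    case (cmult c p)
    then obtain a where "\<forall>t s. p (t *\<^sub>R axis i 1 + s *\<^sub>R axis j 1) = (\<Sum>m\<le>n. a m * of_real (t ^ (n - m) * s ^ m))"
      by blast
    then show ?case by (intro exI[of _ "\<lambda>m. c * a m"]) (simp add: sum_distrib_left mult.assoc)
  next
    case (monomial \<alpha>)
    let ?R = "UNIV - {i, j}"
    have split: "UNIV = insert i (insert j ?R)" by auto
    have prod: "monomial \<alpha> (t *\<^sub>R axis i 1 + s *\<^sub>R axis j 1) =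
        of_real (t ^ \<alpha> i * s ^ \<alpha> j * (\<Prod>k\<in>?R. 0 ^ \<alpha> k))" for t s
    proof -
      have "(\<Prod>k\<in>UNIV. (t *\<^sub>R axis i 1 + s *\<^sub>R axis j (1::real)) $ k ^ \<alpha> k) =
          t ^ \<alpha> i * (s ^ \<alpha> j * (\<Prod>k\<in>?R. (t *\<^sub>R axis i 1 + s *\<^sub>R axis j 1) $ k ^ \<alpha> k))"
        using \<open>i \<noteq> j\<close> by (subst split) (simp add: axis_def)
      also have "(\<Prod>k\<in>?R. (t *\<^sub>R axis i 1 + s *\<^sub>R axis j 1) $ k ^ \<alpha> k) = (\<Prod>k\<in>?R. 0 ^ \<alpha> k)"
        by (intro prod.cong) (auto simp: axis_def)
      finally show ?thesis by (simp add: monomial_def)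
    qed
    have sum: "n = \<alpha> i + \<alpha> j + (\<Sum>k\<in>?R. \<alpha> k)"
    proof -
      have "(\<Sum>k\<in>UNIV. \<alpha> k) = \<alpha> i + (\<alpha> j + (\<Sum>k\<in>?R. \<alpha> k))"
        using \<open>i \<noteq> j\<close> by (subst split) simp
      then show ?thesis using monomial by simp
    qed
    \<comment> \<open>On the plane a monomial survives only if it involves no variable besides those
      of \<open>i\<close> and \<open>j\<close>; it is then the single term with m =
      \<open>\<alpha> j\<close>.\<close>
    show ?case
    proof (cases "\<forall>k\<in>?R. \<alpha> k = 0")
      case True
      then have "n = \<alpha> i + \<alpha> j" using sum by simp
      then show ?thesis using True prod
        by (intro exI[of _ "\<lambda>m. if m = \<alpha> j then 1 else 0"])
          (simp add: if_distrib[of "\<lambda>y. y * _"] cong: if_cong)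
    next
      case False
      then have "(\<Prod>k\<in>?R. (0::real) ^ \<alpha> k) = 0" by (intro prod_zero) auto
      then show ?thesis using prod by (intro exI[of _ "\<lambda>_. 0"]) simp
    qed
  qed
  then show ?thesis using that by blast
qed

text \<open>Lines in the directions \<open>i\<close> and \<open>j\<close> stay in the plane, so the
  expansion may be differentiated term by term. Truncated subtraction in the exponents is harmless:
  whenever an exponent is cut off at 0, one of the numerical factors is 0.\<close>

lemma partial_derivs_plane:
  fixes p :: "real^'d \<Rightarrow> complex"
  assumes p: "p \<in> polyfun"
    and ex: "\<And>t s. p (t *\<^sub>R axis i 1 + s *\<^sub>R axis j 1) = (\<Sum>m\<le>n. a m * of_real (t ^ (n - m) * s ^ m))"
  shows "partial_deriv i p (t *\<^sub>R axis i 1 + s *\<^sub>R axis j 1) =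
      (\<Sum>m\<le>n. a m * of_real (real (n - m) * t ^ (n - m - 1) * s ^ m))"
    and "partial_deriv i (partial_deriv i p) (t *\<^sub>R axis i 1 + s *\<^sub>R axis j 1) =
      (\<Sum>m\<le>n. a m * of_real (real (n - m) * real (n - m - 1) * t ^ (n - m - 2) * s ^ m))"
    and "partial_deriv j p (t *\<^sub>R axis i 1 + s *\<^sub>R axis j 1) =
      (\<Sum>m\<le>n. a m * of_real (t ^ (n - m) * (real m * s ^ (m - 1))))"
    and "partial_deriv j (partial_deriv j p) (t *\<^sub>R axis i 1 + s *\<^sub>R axis j 1) =
      (\<Sum>m\<le>n. a m * of_real (t ^ (n - m) * (real m * real (m - 1) * s ^ (m - 2))))"
proof -
  have pow: "((\<lambda>u. (t + u) ^ k) has_real_derivative real k * t ^ (k - 1)) (at 0)" for t :: real and k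
    by (auto intro!: derivative_eq_intros)
  have deriv_sum: "((\<lambda>u. \<Sum>m\<le>n. a m * of_real (f m u)) has_vector_derivative (\<Sum>m\<le>n. a m * of_real (f' m))) (at 0)"
    if "\<And>m. (f m has_real_derivative f' m) (at 0)" for f f'
    by (intro has_vector_derivative_sum has_vector_derivative_mult_right has_vector_derivative_of_real that)
  have mi: "t *\<^sub>R axis i 1 + s *\<^sub>R axis j 1 + u *\<^sub>R axis i 1 = (t + u) *\<^sub>R axis i 1 + s *\<^sub>R axis j (1::real)"
    and mj: "t *\<^sub>R axis i 1 + s *\<^sub>R axis j 1 + u *\<^sub>R axis j 1 = t *\<^sub>R axis i 1 + (s + u) *\<^sub>R axis j (1::real)"
    for t s u
    by (simp_all add: algebra_simps)
  show i: "partial_deriv i p (t *\<^sub>R axis i 1 + s *\<^sub>R axis j 1) =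
      (\<Sum>m\<le>n. a m * of_real (real (n - m) * t ^ (n - m - 1) * s ^ m))" for t s
    by (intro partial_deriv_eqI) (unfold mi ex, intro deriv_sum DERIV_cmult_right pow)
  show j: "partial_deriv j p (t *\<^sub>R axis i 1 + s *\<^sub>R axis j 1) =
      (\<Sum>m\<le>n. a m * of_real (t ^ (n - m) * (real m * s ^ (m - 1))))" for t s
    by (intro partial_deriv_eqI) (unfold mj ex, intro deriv_sum DERIV_cmult pow)
  have "k - 1 - 1 = k - 2" for k :: nat by simp
  note * = this[of "n - _"]
  show "partial_deriv i (partial_deriv i p) (t *\<^sub>R axis i 1 + s *\<^sub>R axis j 1) =
      (\<Sum>m\<le>n. a m * of_real (real (n - m) * real (n - m - 1) * t ^ (n - m - 2) * s ^ m))"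
    by (intro partial_deriv_eqI)
      (unfold mi i, intro deriv_sum DERIV_cmult_right DERIV_cong[OF DERIV_cmult[OF pow]], simp add: mult.assoc flip: *)
  show "partial_deriv j (partial_deriv j p) (t *\<^sub>R axis i 1 + s *\<^sub>R axis j 1) =
      (\<Sum>m\<le>n. a m * of_real (t ^ (n - m) * (real m * real (m - 1) * s ^ (m - 2))))"
    by (intro partial_deriv_eqI)
      (unfold mj j, intro deriv_sum DERIV_cmult DERIV_cong[OF DERIV_cmult[OF pow]], simp add: mult.assoc numeral_2_eq_2)
qed

text \<open>
  The left-hand side is the spherical Laplacian at the pole \<open>axis i 1\<close>; by
  \<open>second_deriv_along_circle\<close> it only depends on the values on the sphere, so that
  the degree can be read off a spherical harmonic.
\<close>

lemma pole_laplacian: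
  fixes p :: "real^'d \<Rightarrow> complex"
  assumes p: "p \<in> homogeneous_polys n" and harm: "laplacian p (axis i 1) = 0" and d: "CARD('d) \<ge> 2"
  shows "(\<Sum>j\<in>UNIV - {i}. partial_deriv j (partial_deriv j p) (axis i 1) - partial_deriv i p (axis i 1)) =
    - of_nat (n * (n + CARD('d) - 2)) * p (axis i 1)"
proof -
  have "card (UNIV - {i}) > 0" using d by (simp add: card_Diff_singleton)
  then obtain j where ij: "i \<noteq> j" by (metis DiffE card_gt_0_iff ex_in_conv insertI1)
  obtain a where a: "\<And>t s. p (t *\<^sub>R axis i 1 + s *\<^sub>R axis j 1) = (\<Sum>m\<le>n. a m * of_real (t ^ (n - m) * s ^ m))"
    using homogeneous_plane_expansion[OF p ij] by blast
  have s0: "(\<Sum>m\<le>n. a m * of_real (f m * 0 ^ m)) = a 0 * of_real (f 0)" for f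
    by (simp add: power_0_left if_distrib[of "\<lambda>y. _ * y"] if_distrib[of of_real] cong: if_cong)
  note pd = partial_derivs_plane[OF homogeneous_polyfun[OF p] a, where t = 1 and s = 0]
  \<comment> \<open>With t = 1 and s = 0 only the term m = 0 remains; the two derivatives are
    Euler's relations in the radial direction.\<close>
  have vals: "p (axis i 1) = a 0" "partial_deriv i p (axis i 1) = a 0 * of_nat n"
    "partial_deriv i (partial_deriv i p) (axis i 1) = a 0 * of_real (real n * real (n - 1))"
    using a[of 1 0] pd(1,2) s0[of "\<lambda>m. 1"] s0[of "\<lambda>m. real (n - m)"] s0[of "\<lambda>m. real (n - m) * real (n - m - 1)"]
    by simp_all
  \<comment> \<open>Harmonicity trades the d - 1 tangential second derivatives for minus the radial
    one.\<close>
  have "(\<Sum>j\<in>UNIV - {i}. partial_deriv j (partial_deriv j p) (axis i 1)) =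
      - partial_deriv i (partial_deriv i p) (axis i 1)"
    using harm sum.remove[of UNIV i "\<lambda>j. partial_deriv j (partial_deriv j p) (axis i 1)"]
    by (simp add: laplacian_def eq_neg_iff_add_eq_0 add.commute)
  then have "(\<Sum>j\<in>UNIV - {i}. partial_deriv j (partial_deriv j p) (axis i 1) - partial_deriv i p (axis i 1)) =
     - (of_real (real n * real (n - 1)) + of_nat (CARD('d) - 1) * of_nat n) * a 0"
    by (simp add: sum_subtractf vals card_Diff_singleton algebra_simps)
  also have "of_real (real n * real (n - 1)) + of_nat (CARD('d) - 1) * of_nat n =
      (of_nat (n * (n - 1) + (CARD('d) - 1) * n) :: complex)" by simp
  also have "n * (n - 1) + (CARD('d) - 1) * n = n * (n + CARD('d) - 2)"
  proof -
    obtain c where "CARD('d) = 2 + c" using d le_Suc_ex by blast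
    then show ?thesis by (cases n) (simp_all add: algebra_simps)
  qed
  finally show ?thesis by (simp add: vals)
qed

text \<open>Both polynomials have the same spherical Laplacian at the pole, since it is computed
  from their common values on great circles. The factors n (n + d - 2) increase strictly with n, so
  distinct degrees force the value at the pole to be 0.\<close>

lemma harmonic_degree_unique:
  fixes p q :: "real^'d \<Rightarrow> complex"
  assumes d: "CARD('d) \<ge> 2"
    and p: "p \<in> homogeneous_polys m" "\<And>x. laplacian p x = 0"
    and q: "q \<in> homogeneous_polys n" "\<And>x. laplacian q x = 0"
    and eq: "\<And>x. norm x = 1 \<Longrightarrow> p x = q x" and ne: "m \<noteq> n"
  shows "p (axis i 1) = 0"
proof -
  have *: "partial_deriv j (partial_deriv j p) (axis i 1) - partial_deriv i p (axis i 1) =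
      partial_deriv j (partial_deriv j q) (axis i 1) - partial_deriv i q (axis i 1)" if "j \<noteq> i" for j
  proof -
    have "norm (cos u *\<^sub>R axis i 1 + sin u *\<^sub>R axis j (1::real)) = 1" for u
      using that by (simp add: norm_eq_1 inner_add_left inner_add_right inner_axis_axis flip: power2_eq_square)
    then show ?thesis
      using second_deriv_along_circle[OF p(1)[THEN homogeneous_polyfun] q(1)[THEN homogeneous_polyfun],
          of 0 1 i j] eq by simp
  qed
  have "- of_nat (m * (m + CARD('d) - 2)) * p (axis i 1) = - of_nat (n * (n + CARD('d) - 2)) * q (axis i 1)"
    unfolding pole_laplacian[OF p d, symmetric] pole_laplacian[OF q d, symmetric]
    by (intro sum.cong refl) (simp add: *)
  then have "(of_nat (m * (m + CARD('d) - 2)) - of_nat (n * (n + CARD('d) - 2))) * p (axis i 1) = 0"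
    using eq[of "axis i 1"] by (simp add: left_diff_distrib)
  moreover have "m * (m + CARD('d) - 2) \<noteq> n * (n + CARD('d) - 2)"
  proof -
    have "a * (a + CARD('d) - 2) < b * (b + CARD('d) - 2)" if "a < b" for a b
      using that d by (intro mult_strict_mono') auto
    then show ?thesis using ne by (metis linorder_neq_iff)
  qed
  then have "of_nat (m * (m + CARD('d) - 2)) \<noteq> (of_nat (n * (n + CARD('d) - 2)) :: complex)"
    unfolding of_nat_eq_iff .
  ultimately show ?thesis by simp
qed

lemma polynomial_zero_on_reals:
  fixes P :: "complex poly"
  assumes "\<And>s::real. s \<noteq> 0 \<Longrightarrow> poly P (of_real s) = 0"
  shows "P = 0"
proof (rule ccontr)
  assume "P \<noteq> 0"
  then have "finite {z. poly P z = 0}" by (rule poly_roots_finite)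
  moreover have "of_real ` (UNIV - {0::real}) \<subseteq> {z. poly P z = 0}" using assms by auto
  ultimately have "finite (of_real ` (UNIV - {0::real}) :: complex set)" by (rule finite_subset[rotated])
  then have "finite (UNIV - {0::real})" by (rule finite_imageD) (auto simp: inj_on_def)
  then show False by (simp add: infinite_UNIV_char_0)
qed

text \<open>
  In the coordinates \<open>t\<close> along the axis and \<open>s\<close> across it, a zonal harmonic satisfies
  \<open>\<partial>\<^sub>t\<^sup>2 p + \<partial>\<^sub>s\<^sup>2 p + (d - 2) / s * \<partial>\<^sub>s p = 0\<close>, hence its
  coefficients obey a two-step recurrence in the power of \<open>s\<close>.
\<close>

lemma zonal_harmonic_zero:
  fixes p :: "real^'d \<Rightarrow> complex"
  assumes d: "CARD('d) \<ge> 3"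
    and p: "p \<in> homogeneous_polys n" and harm: "\<And>x. laplacian p x = 0"
    and zonal: "\<And>x y. norm x = norm y \<Longrightarrow> x $ i = y $ i \<Longrightarrow> p x = p y"
    and p0: "p (axis i 1) = 0"
  shows "p x = 0"
proof -
  have "card (UNIV - {i}) > 0" using d by (simp add: card_Diff_singleton)
  then obtain j where ij: "i \<noteq> j" by (metis DiffE card_gt_0_iff ex_in_conv insertI1)
  obtain a where a: "\<And>t s. p (t *\<^sub>R axis i 1 + s *\<^sub>R axis j 1) = (\<Sum>m\<le>n. a m * of_real (t ^ (n - m) * s ^ m))"
    using homogeneous_plane_expansion[OF p ij] by blast
  note pf = homogeneous_polyfun[OF p]
  note pd = partial_derivs_plane[OF pf a]
  define e where "e s = axis i 1 + s *\<^sub>R axis j (1::real)" for s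
  \<comment> \<open>The circle around \<open>axis i 1\<close> in the directions of \<open>j\<close>
    and \<open>k\<close> consists of points of equal norm and equal \<open>i\<close>-coordinate.
    Comparing \<open>p\<close> with a constant along it gives the identity; there are d - 2 such
    directions \<open>k\<close>.\<close>
  have transverse: "s\<^sup>2 *\<^sub>R partial_deriv k (partial_deriv k p) (e s) = s *\<^sub>R partial_deriv j p (e s)"
    if k: "k \<noteq> i" "k \<noteq> j" for k s
  proof -
    have "p (axis i 1 + (s * cos u) *\<^sub>R axis j 1 + (s * sin u) *\<^sub>R axis k 1) = p (e s)" for u
    proof (rule zonal)
      have "(s * cos u)\<^sup>2 + (s * sin u)\<^sup>2 = s\<^sup>2"
        by (simp add: power_mult_distrib flip: distrib_left)
      then have "(axis i (1::real) + (s * cos u) *\<^sub>R axis j 1 + (s * sin u) *\<^sub>R axis k 1) \<bullet>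
          (axis i 1 + (s * cos u) *\<^sub>R axis j 1 + (s * sin u) *\<^sub>R axis k 1) = e s \<bullet> e s"
        using ij k by (simp add: e_def inner_add_left inner_add_right inner_axis_axis power2_eq_square)
      then show "norm (axis i (1::real) + (s * cos u) *\<^sub>R axis j 1 + (s * sin u) *\<^sub>R axis k 1) = norm (e s)"
        by (simp only: norm_eq)
      show "(axis i 1 + (s * cos u) *\<^sub>R axis j 1 + (s * sin u) *\<^sub>R axis k 1) $ i = e s $ i"
        using ij k by (simp add: e_def axis_def)
    qed
    then have "s\<^sup>2 *\<^sub>R partial_deriv k (partial_deriv k p) (e s) - s *\<^sub>R partial_deriv j p (e s) =
      s\<^sup>2 *\<^sub>R partial_deriv k (partial_deriv k (\<lambda>x. p (e s))) (e s) - s *\<^sub>R partial_deriv j (\<lambda>x. p (e s)) (e s)"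
      using second_deriv_along_circle[OF pf polyfun.const, of "axis i 1" s j k "p (e s)"]
      by (simp add: e_def)
    also have "\<dots> = 0"
      by (simp add: partial_deriv_def[abs_def])
    finally show ?thesis by simp
  qed
  \<comment> \<open>Coefficients of s^2 times the Laplacian on the line t = 1. \<open>A\<close>
    stems from the second derivative in t, raised by two powers through the factor s^2;
    \<open>B\<close> collects the second derivative in s and the d - 2 transverse
    directions.\<close>
  define A where "A m = a m * of_nat ((n - m) * (n - m - 1))" for m
  define B where "B m = a m * of_nat (m * (m - 1) + (CARD('d) - 2) * m)" for m
  define P where "P = (\<Sum>m\<le>n. monom (A m) (m + 2) + monom (B m) m)"
  have "poly P (of_real s) = 0" if "s \<noteq> 0" for s
  proof -
    let ?D = "\<lambda>k. partial_deriv k (partial_deriv k p) (e s)"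
    have es: "e s = 1 *\<^sub>R axis i 1 + s *\<^sub>R axis j 1" by (simp add: e_def)
    have "0 = s\<^sup>2 *\<^sub>R laplacian p (e s)" by (simp add: harm)
    also have "laplacian p (e s) = ?D i + (?D j + (\<Sum>k\<in>UNIV - {i} - {j}. ?D k))"
      unfolding laplacian_def using ij by (simp add: sum.remove[of _ i] sum.remove[of _ j])
    also have "s\<^sup>2 *\<^sub>R \<dots> = s\<^sup>2 *\<^sub>R ?D i + s\<^sup>2 *\<^sub>R ?D j + (\<Sum>k\<in>UNIV - {i} - {j}. s\<^sup>2 *\<^sub>R ?D k)"
      by (simp add: scaleR_right_distrib scaleR_sum_right)
    also have "(\<Sum>k\<in>UNIV - {i} - {j}. s\<^sup>2 *\<^sub>R ?D k) = (\<Sum>k\<in>UNIV - {i} - {j}. s *\<^sub>R partial_deriv j p (e s))"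
      by (intro sum.cong transverse) auto
    also have "\<dots> = of_nat (CARD('d) - 2) * (s *\<^sub>R partial_deriv j p (e s))"
      using ij by (simp add: card_Diff_singleton numeral_2_eq_2)
    also have "s\<^sup>2 *\<^sub>R ?D i + s\<^sup>2 *\<^sub>R ?D j + of_nat (CARD('d) - 2) * (s *\<^sub>R partial_deriv j p (e s)) = poly P (of_real s)"
    proof -
      have m1: "s * s ^ (m - 1) * real m = s ^ m * real m" for m by (cases m) auto
      have m2: "s\<^sup>2 * s ^ (m - 2) * real (m * (m - 1)) = s ^ m * real (m * (m - 1))" for m
      proof (cases "m \<ge> 2")
        case True
        then obtain k where "m = k + 2" by (metis add.commute le_Suc_ex)
        then show ?thesis by (simp add: power2_eq_square)
      next
        case False
        then have "m = 0 \<or> m = 1" by auto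
        then show ?thesis by auto
      qed
      have i: "s\<^sup>2 *\<^sub>R ?D i = (\<Sum>m\<le>n. A m * of_real s ^ (m + 2))"
        unfolding es pd(2) scaleR_sum_right
        by (intro sum.cong refl) (simp add: A_def scaleR_conv_of_real power_add power2_eq_square)
      have j: "s\<^sup>2 *\<^sub>R ?D j = (\<Sum>m\<le>n. a m * of_nat (m * (m - 1)) * of_real s ^ m)"
      proof -
        have "s\<^sup>2 *\<^sub>R (a m * of_real (1 ^ (n - m) * (real m * real (m - 1) * s ^ (m - 2)))) =
            a m * of_real (s\<^sup>2 * s ^ (m - 2) * real (m * (m - 1)))" for m
          by (simp add: scaleR_conv_of_real)
        then show ?thesis unfolding es pd(4) scaleR_sum_right m2
          by (intro sum.cong refl) simp
      qed
      have j1: "of_nat (CARD('d) - 2) * (s *\<^sub>R partial_deriv j p (e s)) =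
          (\<Sum>m\<le>n. a m * of_nat ((CARD('d) - 2) * m) * of_real s ^ m)"
      proof -
        have "s *\<^sub>R (a m * of_real (1 ^ (n - m) * (real m * s ^ (m - 1)))) =
            a m * of_real (s * s ^ (m - 1) * real m)" for m
          by (simp add: scaleR_conv_of_real)
        then show ?thesis unfolding es pd(3) scaleR_sum_right m1 sum_distrib_left
          by (intro sum.cong refl) simp
      qed
      show ?thesis unfolding i j j1
        by (simp only: P_def B_def poly_sum poly_monom poly_add sum.distrib of_nat_add
            distrib_left distrib_right add.assoc)
    qed
    finally show ?thesis by simp
  qed
  then have "P = 0" by (rule polynomial_zero_on_reals)
  have "a m = 0" if "m \<le> n" for m
    using that
  proof (induction m rule: less_induct)
    case (less m)
    show ?case
    proof (cases "m = 0")
      case True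
      have "(\<Sum>m\<le>n. a m * of_real (1 ^ (n - m) * 0 ^ m)) = a 0"
        by (simp add: power_0_left if_distrib[of "\<lambda>y. _ * y"] if_distrib[of of_real] cong: if_cong)
      then show ?thesis using True a[of 1 0] p0 by simp
    next
      case False
      \<comment> \<open>This coefficient is \<open>B m\<close>, plus the value of \<open>A\<close>
        at m - 2 if m \<ge> 2, which is 0 by induction.\<close>
      have "0 = coeff P m" by (simp add: \<open>P = 0\<close>)
      also have "\<dots> = (\<Sum>l\<le>n. if l + 2 = m then A l else 0) + (\<Sum>l\<le>n. if l = m then B l else 0)"
        by (simp add: P_def coeff_sum sum.distrib)
      also have "(\<Sum>l\<le>n. if l + 2 = m then A l else 0) = 0"
        by (intro sum.neutral) (auto simp: A_def less.IH)
      also have "(\<Sum>l\<le>n. if l = m then B l else 0) = B m" using less.prems by simp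
      finally have "B m = 0" by simp
      \<comment> \<open>For m = 1 the first summand is 0, so positivity rests on d > 2.\<close>
      moreover have "m * (m - 1) + (CARD('d) - 2) * m \<noteq> 0" using d False by auto
      ultimately show ?thesis unfolding B_def mult_eq_0_iff of_nat_eq_0_iff by blast
    qed
  qed
  then have plane: "p (t *\<^sub>R axis i 1 + s *\<^sub>R axis j 1) = 0" for t s by (simp add: a)
  \<comment> \<open>Every point shares its norm and its \<open>i\<close>-coordinate with a point of
    the plane, so zonality carries the vanishing to the whole space.\<close>
  have "(x $ i)\<^sup>2 \<le> (norm x)\<^sup>2"
    using component_le_norm_cart[of x i] by (simp add: power2_le_iff_abs_le)
  then have "norm x = norm (x $ i *\<^sub>R axis i 1 + sqrt ((norm x)\<^sup>2 - (x $ i)\<^sup>2) *\<^sub>R axis j (1::real))"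
    using ij by (simp add: norm_eq_sqrt_inner inner_add_left inner_add_right inner_axis_axis
        flip: power2_eq_square)
  then have "p x = p (x $ i *\<^sub>R axis i 1 + sqrt ((norm x)\<^sup>2 - (x $ i)\<^sup>2) *\<^sub>R axis j 1)"
    using ij by (intro zonal) (simp_all add: axis_def)
  then show ?thesis by (simp add: plane)
qed

section \<open>Frames\<close>

lemma am_gm_weighted:
  fixes a b t :: real
  assumes "t > 0"
  shows "a * b \<le> (t * a\<^sup>2 + b\<^sup>2 / t) / 2"
proof -
  have "t * a\<^sup>2 + b\<^sup>2 / t - 2 * (a * b) = (t * a - b)\<^sup>2 / t"
    using assms by (simp add: field_simps power2_eq_square)
  also have "\<dots> \<ge> 0" using assms by simp
  finally show ?thesis by simp
qed

lemma measurable_cnj: "f \<in> borel_measurable M \<Longrightarrow> (\<lambda>x. cnj (f x)) \<in> borel_measurable M"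
  by (rule borel_measurable_continuous_on[of cnj]) (auto intro: continuous_intros)

lemma L2_I: "f \<in> borel_measurable M \<Longrightarrow> integrable M (\<lambda>x. (cmod (f x))\<^sup>2) \<Longrightarrow> f \<in> L2 M"
  by (simp add: L2_def)

lemma L2_measurable: "f \<in> L2 M \<Longrightarrow> f \<in> borel_measurable M"
  and L2_square_integrable: "f \<in> L2 M \<Longrightarrow> integrable M (\<lambda>x. (cmod (f x))\<^sup>2)"
  by (auto simp: L2_def)

lemma L2_integrable_inner:
  assumes "f \<in> L2 M" "g \<in> L2 M"
  shows "integrable M (\<lambda>x. f x * cnj (g x))"
proof (rule Bochner_Integration.integrable_bound)
  show "integrable M (\<lambda>x. (cmod (f x))\<^sup>2 + (cmod (g x))\<^sup>2)"
    using assms by (intro Bochner_Integration.integrable_add L2_square_integrable)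
  show "(\<lambda>x. f x * cnj (g x)) \<in> borel_measurable M"
    using assms[THEN L2_measurable] by (intro borel_measurable_times measurable_cnj)
  have "a * b \<le> a\<^sup>2 + b\<^sup>2" if "a \<ge> 0" "b \<ge> 0" for a b :: real
    using sum_squares_bound[of a b] mult_nonneg_nonneg[OF that] by linarith
  then show "AE x in M. norm (f x * cnj (g x)) \<le> norm ((cmod (f x))\<^sup>2 + (cmod (g x))\<^sup>2)"
    by (simp add: norm_mult)
qed

lemma L2_zero: "(\<lambda>x. 0) \<in> L2 M"
  by (simp add: L2_def)

lemma L2_cmult: "f \<in> L2 M \<Longrightarrow> (\<lambda>x. c * f x) \<in> L2 M"
  by (auto simp: L2_def norm_mult power_mult_distrib)

lemma norm_sum_squared_le: "(cmod (a + b))\<^sup>2 \<le> 2 * (cmod a)\<^sup>2 + 2 * (cmod b)\<^sup>2"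
proof -
  have "(cmod (a + b))\<^sup>2 \<le> (cmod a + cmod b)\<^sup>2" by (intro power_mono norm_triangle_ineq) simp
  also have "\<dots> \<le> 2 * (cmod a)\<^sup>2 + 2 * (cmod b)\<^sup>2"
    using sum_squares_bound[of "cmod a" "cmod b"] by (simp add: power2_sum)
  finally show ?thesis .
qed

lemma L2_add:
  assumes "f \<in> L2 M" "g \<in> L2 M"
  shows "(\<lambda>x. f x + g x) \<in> L2 M"
proof (rule L2_I)
  show m: "(\<lambda>x. f x + g x) \<in> borel_measurable M"
    using assms[THEN L2_measurable] by measurable
  show "integrable M (\<lambda>x. (cmod (f x + g x))\<^sup>2)"
  proof (rule Bochner_Integration.integrable_bound)
    show "integrable M (\<lambda>x. 2 * (cmod (f x))\<^sup>2 + 2 * (cmod (g x))\<^sup>2)"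
      using assms[THEN L2_square_integrable] by simp
    show "(\<lambda>x. (cmod (f x + g x))\<^sup>2) \<in> borel_measurable M" using m by measurable
  qed (use norm_sum_squared_le in auto)
qed

lemma L2_diff: "f \<in> L2 M \<Longrightarrow> g \<in> L2 M \<Longrightarrow> (\<lambda>x. f x - g x) \<in> L2 M"
  using L2_add[of f M "\<lambda>x. (-1) * g x"] L2_cmult[of g M "-1"] by simp

lemma L2_sum: "(\<And>i. i \<in> F \<Longrightarrow> f i \<in> L2 M) \<Longrightarrow> (\<lambda>x. \<Sum>i\<in>F. f i x) \<in> L2 M"
  by (induction F rule: infinite_finite_induct) (auto intro: L2_zero L2_add)

lemma L2_inner_cnj: "L2_inner M g f = cnj (L2_inner M f g)"
  using Bochner_Integration.integral_cnj[of M "\<lambda>x. f x * cnj (g x)"]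
  by (simp add: L2_inner_def mult.commute)

lemma L2_inner_cmult_left: "L2_inner M (\<lambda>x. c * f x) g = c * L2_inner M f g"
  by (simp add: L2_inner_def mult.assoc)

lemma L2_inner_diff_left:
  assumes "f \<in> L2 M" "f' \<in> L2 M" "g \<in> L2 M"
  shows "L2_inner M (\<lambda>x. f x - f' x) g = L2_inner M f g - L2_inner M f' g"
  using L2_integrable_inner[OF assms(1,3)] L2_integrable_inner[OF assms(2,3)]
  by (simp add: L2_inner_def left_diff_distrib)

lemma L2_inner_sum_left:
  assumes "\<And>i. i \<in> F \<Longrightarrow> f i \<in> L2 M" "g \<in> L2 M"
  shows "L2_inner M (\<lambda>x. \<Sum>i\<in>F. f i x) g = (\<Sum>i\<in>F. L2_inner M (f i) g)"
  using L2_integrable_inner[OF assms(1) assms(2)]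
  by (simp add: L2_inner_def sum_distrib_right)

lemma L2_norm_square: "(L2_norm M f)\<^sup>2 = (LINT x|M. (cmod (f x))\<^sup>2)"
  by (simp add: L2_norm_def)

lemma L2_norm_nonneg: "L2_norm M f \<ge> 0"
  by (simp add: L2_norm_def)

lemma L2_inner_self: "L2_inner M f f = of_real ((L2_norm M f)\<^sup>2)"
  by (simp only: L2_inner_def L2_norm_square complex_norm_square[symmetric] integral_complex_of_real)

lemma L2_norm_cmult: "L2_norm M (\<lambda>x. c * f x) = cmod c * L2_norm M f"
  by (simp add: L2_norm_def norm_mult power_mult_distrib real_sqrt_mult)

lemma L2_norm_diff_square_le:
  assumes "f \<in> L2 M" "g \<in> L2 M"
  shows "(L2_norm M (\<lambda>x. f x - g x))\<^sup>2 \<le> 2 * (L2_norm M f)\<^sup>2 + 2 * (L2_norm M g)\<^sup>2"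
proof -
  have "(LINT x|M. (cmod (f x - g x))\<^sup>2) \<le> (LINT x|M. 2 * (cmod (f x))\<^sup>2 + 2 * (cmod (g x))\<^sup>2)"
    using L2_square_integrable[OF L2_diff[OF assms]] assms[THEN L2_square_integrable]
      norm_sum_squared_le[of "f _" "- g _"]
    by (intro integral_mono) auto
  then show ?thesis
    using assms[THEN L2_square_integrable] by (simp add: L2_norm_square)
qed

text \<open>A weighted form of the Cauchy-Schwarz inequality. The weight stays a parameter, so that
  in \<open>frame_operator_injective\<close> it can be chosen after a limit has been taken.\<close>

lemma L2_inner_le:
  assumes "f \<in> L2 M" "g \<in> L2 M" "t > 0"
  shows "cmod (L2_inner M f g) \<le> (t * (L2_norm M f)\<^sup>2 + (L2_norm M g)\<^sup>2 / t) / 2"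
proof -
  have "norm (f x * cnj (g x)) \<le> (t * (cmod (f x))\<^sup>2 + (cmod (g x))\<^sup>2 / t) / 2" for x
    unfolding norm_mult complex_mod_cnj by (intro am_gm_weighted assms)
  then have "(LINT x|M. norm (f x * cnj (g x))) \<le> (LINT x|M. (t * (cmod (f x))\<^sup>2 + (cmod (g x))\<^sup>2 / t) / 2)"
    using assms(1,2)[THEN L2_square_integrable]
    by (intro integral_mono integrable_norm L2_integrable_inner assms)
      auto
  also have "\<dots> = (t * (L2_norm M f)\<^sup>2 + (L2_norm M g)\<^sup>2 / t) / 2"
    using assms(1,2)[THEN L2_square_integrable] by (simp add: L2_norm_square)
  finally show ?thesis
    unfolding L2_inner_def by (rule order_trans[OF integral_norm_bound])
qed

lemma L2_norm_zero_AE: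
  assumes "f \<in> L2 M" "L2_norm M f = 0"
  shows "AE x in M. f x = 0"
  using assms integral_nonneg_eq_0_iff_AE[of M "\<lambda>x. (cmod (f x))\<^sup>2"] L2_square_integrable[OF assms(1)]
  by (simp add: L2_norm_def)

text \<open>Duality of analysis and synthesis: the squared norm of the sum u is the pairing of the
  \<open>c i\<close> with the frame coefficients of u. The weight \<open>B\<close> in the
  arithmetic-geometric inequality lets the Bessel bound return half of that squared norm, which is
  absorbed on the left.\<close>

lemma synthesis_bound:
  assumes \<phi>: "\<And>i. i \<in> F \<Longrightarrow> \<phi> i \<in> L2 M" and B: "B > 0"
    and bessel: "\<And>f. f \<in> L2 M \<Longrightarrow> (\<Sum>i\<in>F. (cmod (L2_inner M f (\<phi> i)))\<^sup>2) \<le> B * (L2_norm M f)\<^sup>2"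
  shows "(L2_norm M (\<lambda>x. \<Sum>i\<in>F. c i * \<phi> i x))\<^sup>2 \<le> B * (\<Sum>i\<in>F. (cmod (c i))\<^sup>2)"
proof -
  define u where "u x = (\<Sum>i\<in>F. c i * \<phi> i x)" for x
  have u: "u \<in> L2 M" unfolding u_def by (intro L2_sum L2_cmult \<phi>)
  have "of_real ((L2_norm M u)\<^sup>2) = (\<Sum>i\<in>F. c i * L2_inner M (\<phi> i) u)"
    unfolding L2_inner_self[symmetric] u_def[of _, abs_def]
    by (subst L2_inner_sum_left)
      (auto intro!: \<phi> L2_cmult u[unfolded u_def[abs_def]] simp: L2_inner_cmult_left)
  then have "(L2_norm M u)\<^sup>2 = cmod (\<Sum>i\<in>F. c i * L2_inner M (\<phi> i) u)"
    by (metis norm_of_real abs_of_nonneg zero_le_power2)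
  also have "\<dots> \<le> (\<Sum>i\<in>F. cmod (c i) * cmod (L2_inner M u (\<phi> i)))"
    by (rule order_trans[OF norm_sum]) (simp add: norm_mult L2_inner_cnj[of M _ u])
  also have "\<dots> \<le> (\<Sum>i\<in>F. (B * (cmod (c i))\<^sup>2 + (cmod (L2_inner M u (\<phi> i)))\<^sup>2 / B) / 2)"
    by (intro sum_mono am_gm_weighted B)
  also have "\<dots> = (B * (\<Sum>i\<in>F. (cmod (c i))\<^sup>2) + (\<Sum>i\<in>F. (cmod (L2_inner M u (\<phi> i)))\<^sup>2) / B) / 2"
    by (simp add: sum.distrib sum_distrib_left flip: sum_divide_distrib)
  also have "\<dots> \<le> (B * (\<Sum>i\<in>F. (cmod (c i))\<^sup>2) + (L2_norm M u)\<^sup>2) / 2"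
    using bessel[OF u] B by (simp add: field_simps)
  finally show ?thesis by (simp add: u_def[abs_def])
qed

text \<open>Convergence along one exhausting sequence \<open>G\<close> implies convergence along all
  finite subsets: a large finite set \<open>F\<close> lies in some \<open>G n\<close> with small
  error, and the part of the series over \<open>G n - F\<close> is controlled by
  \<open>synthesis_bound\<close> and the Cauchy property of the summable frame coefficients. This
  allows sums to be taken level by level.\<close>

lemma frame_operator_mapsI:
  fixes \<phi> :: "'i \<Rightarrow> 'a \<Rightarrow> complex" and G :: "nat \<Rightarrow> 'i set"
  assumes frame: "is_frame M J \<phi>" and f: "f \<in> L2 M" and h: "h \<in> L2 M"
    and G: "\<And>n. finite (G n)" "\<And>n. G n \<subseteq> J"
      "\<And>F. finite F \<Longrightarrow> F \<subseteq> J \<Longrightarrow> eventually (\<lambda>n. F \<subseteq> G n) sequentially"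
    and lim: "(\<lambda>n. L2_norm M (\<lambda>x. h x - (\<Sum>i\<in>G n. L2_inner M f (\<phi> i) * \<phi> i x))) \<longlonglongrightarrow> 0"
  shows "frame_operator_maps M J \<phi> f h"
proof -
  obtain A B where AB: "0 < A" "A \<le> B"
    and fr: "\<And>f. f \<in> L2 M \<Longrightarrow> (\<lambda>i. (cmod (L2_inner M f (\<phi> i)))\<^sup>2) summable_on J"
      "\<And>f. f \<in> L2 M \<Longrightarrow> (\<Sum>\<^sub>\<infinity>i\<in>J. (cmod (L2_inner M f (\<phi> i)))\<^sup>2) \<le> B * (L2_norm M f)\<^sup>2"
    and \<phi>: "\<And>i. i \<in> J \<Longrightarrow> \<phi> i \<in> L2 M"
    using frame unfolding is_frame_def by blast
  have B: "B > 0" using AB by linarith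
  have bessel: "(\<Sum>i\<in>F. (cmod (L2_inner M u (\<phi> i)))\<^sup>2) \<le> B * (L2_norm M u)\<^sup>2"
    if "finite F" "F \<subseteq> J" "u \<in> L2 M" for F u
    using finite_sum_le_infsum[OF fr(1)[OF that(3)] that(1,2)] fr(2)[OF that(3)] by simp
  define S where "S F x = (\<Sum>i\<in>F. L2_inner M f (\<phi> i) * \<phi> i x)" for F x
  have S: "S F \<in> L2 M" if "F \<subseteq> J" for F
    unfolding S_def using that by (intro L2_sum L2_cmult \<phi>) auto
  define a where "a i = (cmod (L2_inner M f (\<phi> i)))\<^sup>2" for i
  have "(a has_sum infsum a J) J"
    using fr(1)[OF f] by (simp add: a_def[abs_def])
  then have a_lim: "(sum a \<longlongrightarrow> infsum a J) (finite_subsets_at_top J)"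
    by (simp add: has_sum_def)
  have "((\<lambda>F. L2_norm M (\<lambda>x. h x - S F x)) \<longlongrightarrow> 0) (finite_subsets_at_top J)"
  proof (rule tendstoI)
    fix \<epsilon> :: real assume \<epsilon>: "\<epsilon> > 0"
    \<comment> \<open>Balanced so that the two terms of the final estimate, 2 (\<epsilon> / 2)^2 and
      2 B (2 \<delta>), are \<epsilon>^2 / 2 each.\<close>
    define \<delta> where "\<delta> = \<epsilon>\<^sup>2 / (8 * B)"
    have \<delta>: "\<delta> > 0" using \<epsilon> B by (simp add: \<delta>_def)
    have "\<exists>F0. finite F0 \<and> F0 \<subseteq> J \<and>
        (\<forall>F. finite F \<and> F0 \<subseteq> F \<and> F \<subseteq> J \<longrightarrow> dist (sum a F) (infsum a J) < \<delta>)"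
      using tendstoD[OF a_lim \<delta>] unfolding eventually_finite_subsets_at_top .
    then obtain F0 where F0: "finite F0" "F0 \<subseteq> J"
      "\<And>F. finite F \<Longrightarrow> F0 \<subseteq> F \<Longrightarrow> F \<subseteq> J \<Longrightarrow> dist (sum a F) (infsum a J) < \<delta>"
      by metis
    have "dist (L2_norm M (\<lambda>x. h x - S F x)) 0 < \<epsilon>" if F: "finite F" "F0 \<subseteq> F" "F \<subseteq> J" for F
    proof -
      have "eventually (\<lambda>n. L2_norm M (\<lambda>x. h x - S (G n) x) < \<epsilon> / 2) sequentially"
        using order_tendstoD(2)[OF lim, of "\<epsilon> / 2"] \<epsilon> by (simp add: S_def)
      with G(3)[OF F(1,3)] have "eventually (\<lambda>n. F \<subseteq> G n \<and> L2_norm M (\<lambda>x. h x - S (G n) x) < \<epsilon> / 2) sequentially"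
        by eventually_elim simp
      then have "\<exists>n. F \<subseteq> G n \<and> L2_norm M (\<lambda>x. h x - S (G n) x) < \<epsilon> / 2"
        by (rule eventually_happens'[OF sequentially_bot])
      then obtain n where n: "F \<subseteq> G n" "L2_norm M (\<lambda>x. h x - S (G n) x) < \<epsilon> / 2"
        by (elim exE conjE)
      have "S (G n) x = S (G n - F) x + S F x" for x
        unfolding S_def by (rule sum.subset_diff[OF n(1) G(1)])
      then have D: "h x - S F x = (h x - S (G n) x) - (- 1 * S (G n - F) x)" for x
        by simp
      have "(L2_norm M (\<lambda>x. h x - S F x))\<^sup>2 \<le> 2 * (L2_norm M (\<lambda>x. h x - S (G n) x))\<^sup>2 + 2 * (L2_norm M (\<lambda>x. -1 * S (G n - F) x))\<^sup>2"
        unfolding D using G(2) by (intro L2_norm_diff_square_le L2_diff L2_cmult h S) auto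
      also have "(L2_norm M (\<lambda>x. -1 * S (G n - F) x))\<^sup>2 = (L2_norm M (S (G n - F)))\<^sup>2"
        by (simp only: L2_norm_cmult) simp
      also have "\<dots> \<le> B * sum a (G n - F)"
        unfolding S_def a_def using G(1,2)[of n]
        by (intro synthesis_bound \<phi> B bessel) auto
      also have "sum a (G n - F) = sum a (G n) - sum a F"
        using n(1) G(1) by (intro sum_diff) auto
      also have "\<dots> < 2 * \<delta>"
      proof -
        have "F0 \<subseteq> G n" using F(2) n(1) by auto
        from F0(3)[OF G(1) this G(2)] F0(3)[OF F] show ?thesis by (simp add: dist_real_def)
      qed
      also have "(L2_norm M (\<lambda>x. h x - S (G n) x))\<^sup>2 < (\<epsilon> / 2)\<^sup>2"
        using n(2) L2_norm_nonneg by (intro power_strict_mono) auto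
      also have "2 * (\<epsilon> / 2)\<^sup>2 + 2 * (B * (2 * \<delta>)) = \<epsilon>\<^sup>2"
        using B by (simp add: \<delta>_def field_simps)
      finally have "(L2_norm M (\<lambda>x. h x - S F x))\<^sup>2 < \<epsilon>\<^sup>2" using B by simp
      then show ?thesis using \<epsilon> L2_norm_nonneg[of M "\<lambda>x. h x - S F x"]
        by (simp add: power2_less_imp_less)
    qed
    then show "eventually (\<lambda>F. dist (L2_norm M (\<lambda>x. h x - S F x)) 0 < \<epsilon>) (finite_subsets_at_top J)"
      unfolding eventually_finite_subsets_at_top using F0(1,2) by blast
  qed
  then show ?thesis using f h by (simp add: frame_operator_maps_def S_def)
qed

text \<open>The frame energy of the difference \<open>D\<close> is the limit of the partial sums of
  the frame series of \<open>D\<close>, paired with \<open>D\<close>. These partial sums tend to 0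
  in norm, so the energy is 0 and the lower frame bound gives \<open>D\<close> = 0 almost
  everywhere.\<close>

lemma frame_operator_injective:
  fixes \<phi> :: "'i \<Rightarrow> 'a \<Rightarrow> complex"
  assumes frame: "is_frame M J \<phi>"
    and f: "frame_operator_maps M J \<phi> f h" and f': "frame_operator_maps M J \<phi> f' h"
  shows "AE x in M. f x = f' x"
proof -
  obtain A B where AB: "0 < A" "A \<le> B"
    and fr: "\<And>f. f \<in> L2 M \<Longrightarrow> (\<lambda>i. (cmod (L2_inner M f (\<phi> i)))\<^sup>2) summable_on J"
      "\<And>f. f \<in> L2 M \<Longrightarrow> A * (L2_norm M f)\<^sup>2 \<le> (\<Sum>\<^sub>\<infinity>i\<in>J. (cmod (L2_inner M f (\<phi> i)))\<^sup>2)"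
    and \<phi>: "\<And>i. i \<in> J \<Longrightarrow> \<phi> i \<in> L2 M"
    using frame unfolding is_frame_def by blast
  define r where "r f F x = h x - (\<Sum>i\<in>F. L2_inner M f (\<phi> i) * \<phi> i x)" for f F x
  have L2s: "f \<in> L2 M" "f' \<in> L2 M" "h \<in> L2 M"
    and lims: "((\<lambda>F. L2_norm M (r f F)) \<longlongrightarrow> 0) (finite_subsets_at_top J)"
      "((\<lambda>F. L2_norm M (r f' F)) \<longlongrightarrow> 0) (finite_subsets_at_top J)"
    using f f' by (simp_all add: frame_operator_maps_def r_def[abs_def])
  define D where "D x = f x - f' x" for x
  have D: "D \<in> L2 M" unfolding D_def by (intro L2_diff L2s)
  have r: "r u F \<in> L2 M" if "F \<subseteq> J" for u F
    unfolding r_def using that by (intro L2_diff L2_sum L2_cmult L2s \<phi>) auto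
  define a where "a i = (cmod (L2_inner M D (\<phi> i)))\<^sup>2" for i
  have "(a has_sum infsum a J) J" using fr(1)[OF D] by (simp add: a_def[abs_def])
  then have a_lim: "(sum a \<longlongrightarrow> infsum a J) (finite_subsets_at_top J)" by (simp add: has_sum_def)
  have le: "sum a F \<le> (t * (2 * (L2_norm M (r f' F))\<^sup>2 + 2 * (L2_norm M (r f F))\<^sup>2) + (L2_norm M D)\<^sup>2 / t) / 2"
    if F: "finite F" "F \<subseteq> J" and t: "t > 0" for F t
  proof -
    have \<phi>F: "\<phi> i \<in> L2 M" if "i \<in> F" for i using that F \<phi> by auto
    have "of_real (sum a F) = (\<Sum>i\<in>F. L2_inner M D (\<phi> i) * L2_inner M (\<phi> i) D)"
      by (simp only: a_def of_real_sum complex_norm_square L2_inner_cnj[of M _ D])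
    also have "\<dots> = L2_inner M (\<lambda>x. \<Sum>i\<in>F. L2_inner M D (\<phi> i) * \<phi> i x) D"
      by (subst L2_inner_sum_left) (auto intro!: L2_cmult \<phi>F D simp: L2_inner_cmult_left)
    \<comment> \<open>The common image \<open>h\<close> cancels and leaves a difference of two
      remainders that both tend to 0 in norm.\<close>
    also have "(\<lambda>x. \<Sum>i\<in>F. L2_inner M D (\<phi> i) * \<phi> i x) = (\<lambda>x. r f' F x - r f F x)"
      using \<phi>F by (simp add: r_def D_def[abs_def] L2_inner_diff_left L2s left_diff_distrib sum_subtractf)
    finally have "sum a F = cmod (L2_inner M (\<lambda>x. r f' F x - r f F x) D)"
      by (metis norm_of_real abs_of_nonneg a_def sum_nonneg zero_le_power2)
    also have "\<dots> \<le> (t * (L2_norm M (\<lambda>x. r f' F x - r f F x))\<^sup>2 + (L2_norm M D)\<^sup>2 / t) / 2"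
      by (intro L2_inner_le L2_diff r F D t)
    also have "\<dots> \<le> (t * (2 * (L2_norm M (r f' F))\<^sup>2 + 2 * (L2_norm M (r f F))\<^sup>2) + (L2_norm M D)\<^sup>2 / t) / 2"
      using t L2_norm_diff_square_le[OF r r, of F F f' f] F by simp
    finally show ?thesis .
  qed
  have "infsum a J \<le> (L2_norm M D)\<^sup>2 / t / 2" if t: "t > 0" for t
  proof (rule tendsto_le[OF _ _ a_lim])
    have "((\<lambda>F. (t * (2 * (L2_norm M (r f' F))\<^sup>2 + 2 * (L2_norm M (r f F))\<^sup>2) + (L2_norm M D)\<^sup>2 / t) / 2)
      \<longlongrightarrow> (t * (2 * 0\<^sup>2 + 2 * 0\<^sup>2) + (L2_norm M D)\<^sup>2 / t) / 2) (finite_subsets_at_top J)"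
      by (intro tendsto_intros lims) auto
    then show "((\<lambda>F. (t * (2 * (L2_norm M (r f' F))\<^sup>2 + 2 * (L2_norm M (r f F))\<^sup>2) + (L2_norm M D)\<^sup>2 / t) / 2)
      \<longlongrightarrow> (L2_norm M D)\<^sup>2 / t / 2) (finite_subsets_at_top J)" by simp
    show "eventually (\<lambda>F. sum a F \<le> (t * (2 * (L2_norm M (r f' F))\<^sup>2 + 2 * (L2_norm M (r f F))\<^sup>2)
        + (L2_norm M D)\<^sup>2 / t) / 2) (finite_subsets_at_top J)"
      using le t by (intro eventually_finite_subsets_at_top_weakI) auto
  qed simp
  then have bound: "A * (L2_norm M D)\<^sup>2 \<le> (L2_norm M D)\<^sup>2 / t / 2" if "t > 0" for t
    using fr(2)[OF D] that by (force simp: a_def[abs_def])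
  have "(L2_norm M D)\<^sup>2 = 0"
  proof -
    \<comment> \<open>With the weight 1 / A the right-hand side is half of the left-hand
      side.\<close>
    have "A * (L2_norm M D)\<^sup>2 \<le> (L2_norm M D)\<^sup>2 / (1 / A) / 2" using AB by (intro bound) simp
    then have "A * (L2_norm M D)\<^sup>2 \<le> 0" by (simp add: mult.commute)
    then show ?thesis using AB(1) by (simp add: mult_le_0_iff)
  qed
  then have "AE x in M. D x = 0" using L2_norm_zero_AE[OF D] by simp
  then show ?thesis by (simp add: D_def)
qed

lemma frame_operator_maps_cong_AE:
  assumes "frame_operator_maps M J \<phi> f h" "f' \<in> L2 M" "AE x in M. f' x = f x"
    and \<phi>: "\<And>i. i \<in> J \<Longrightarrow> \<phi> i \<in> L2 M"
  shows "frame_operator_maps M J \<phi> f' h"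
proof -
  have f: "f \<in> L2 M" using assms(1) by (simp add: frame_operator_maps_def)
  have eq: "L2_inner M f' (\<phi> i) = L2_inner M f (\<phi> i)" if "i \<in> J" for i
    unfolding L2_inner_def
    using assms(3) L2_integrable_inner[OF assms(2) \<phi>[OF that]] L2_integrable_inner[OF f \<phi>[OF that]]
    by (intro integral_cong_AE) auto
  have "eventually (\<lambda>F. L2_norm M (\<lambda>x. h x - (\<Sum>i\<in>F. L2_inner M f (\<phi> i) * \<phi> i x)) =
      L2_norm M (\<lambda>x. h x - (\<Sum>i\<in>F. L2_inner M f' (\<phi> i) * \<phi> i x))) (finite_subsets_at_top J)"
  proof (rule eventually_finite_subsets_at_top_weakI)
    fix F assume "F \<subseteq> J"
    then have "(\<Sum>i\<in>F. L2_inner M f (\<phi> i) * \<phi> i x) = (\<Sum>i\<in>F. L2_inner M f' (\<phi> i) * \<phi> i x)" for x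
      by (intro sum.cong) (auto simp: eq)
    then show "L2_norm M (\<lambda>x. h x - (\<Sum>i\<in>F. L2_inner M f (\<phi> i) * \<phi> i x)) =
      L2_norm M (\<lambda>x. h x - (\<Sum>i\<in>F. L2_inner M f' (\<phi> i) * \<phi> i x))" by simp
  qed
  then show ?thesis
    using assms(1,2) by (auto simp: frame_operator_maps_def elim: Lim_transform_eventually)
qed

text \<open>Injectivity yields one direction of the required equivalence; that every representative
  of the class of \<open>\<psi> i\<close> is a preimage is
  \<open>frame_operator_maps_cong_AE\<close>.\<close>

lemma is_canonical_dual_frameI:
  assumes "is_frame M J \<phi>" "\<And>i. i \<in> J \<Longrightarrow> frame_operator_maps M J \<phi> (\<psi> i) (\<phi> i)"
  shows "is_canonical_dual_frame M J \<phi> \<psi>"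
proof -
  have \<phi>: "\<phi> i \<in> L2 M" if "i \<in> J" for i using assms(1) that by (simp add: is_frame_def)
  have "frame_operator_maps M J \<phi> f (\<phi> i) \<longleftrightarrow> (AE x in M. f x = \<psi> i x)"
    if "i \<in> J" "f \<in> L2 M" for i f
    using frame_operator_injective[OF assms(1) _ assms(2)[OF that(1)]]
      frame_operator_maps_cong_AE[OF assms(2)[OF that(1)] that(2) _ \<phi>] by blast
  then show ?thesis
    using assms by (auto simp: is_canonical_dual_frame_def frame_operator_maps_def)
qed

section \<open>Spherical harmonics and invariant kernels\<close>

locale spherical_onb =
  fixes \<omega> :: "(real^'d) measure"
    and I :: "nat \<Rightarrow> 'k set"
    and Y :: "nat \<Rightarrow> 'k \<Rightarrow> real^'d \<Rightarrow> complex"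
  assumes card_dim: "CARD('d) \<ge> 3"
    and sphere_measure: "is_normalized_sphere_measure \<omega>"
    and onb: "harmonic_onb \<omega> I Y"
begin

section \<open>Integration on the sphere and orthonormal expansions\<close>

abbreviation H :: "nat \<Rightarrow> (real^'d \<Rightarrow> complex) set" where "H \<equiv> sph_harmonics"

lemma space_\<omega>: "space \<omega> = sphere 0 1"
  and sets_\<omega>: "sets \<omega> = sets (restrict_space borel (sphere 0 1))"
  using sphere_measure by (auto simp: is_normalized_sphere_measure_def)

lemma finite_\<omega>: "finite_measure \<omega>"
  using sphere_measure by (intro finite_measureI) (auto simp: is_normalized_sphere_measure_def)

lemma SO_sphere [simp]: "h \<in> SO \<Longrightarrow> h *v x \<in> sphere 0 1 \<longleftrightarrow> x \<in> sphere 0 1" for x :: "real^'d"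
  by (simp add: SO_norm)

lemma continuous_measurable: "continuous_on (sphere 0 1) f \<Longrightarrow> f \<in> borel_measurable \<omega>" for f :: "real^'d \<Rightarrow> complex"
  using borel_measurable_continuous_on_restrict[of "sphere 0 1" f] measurable_cong_sets[OF sets_\<omega> refl] by blast

lemma continuous_integrable:
  fixes f :: "real^'d \<Rightarrow> complex"
  assumes "continuous_on (sphere 0 1) f"
  shows "integrable \<omega> f"
proof -
  interpret finite_measure \<omega> by (rule finite_\<omega>)
  have "bounded (f ` sphere 0 1)"
    using assms by (intro compact_imp_bounded compact_continuous_image) auto
  then obtain B where "\<And>x. x \<in> sphere 0 1 \<Longrightarrow> norm (f x) \<le> B" by (metis bounded_iff imageI)
  then show ?thesis
    by (intro integrable_const_bound[where B = B] continuous_measurable assms) (auto simp: space_\<omega>)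
qed

lemma continuous_L2: "continuous_on (sphere 0 1) f \<Longrightarrow> f \<in> L2 \<omega>"
proof (rule L2_I)
  assume f: "continuous_on (sphere 0 1) f"
  then show "f \<in> borel_measurable \<omega>" by (rule continuous_measurable)
  have "integrable \<omega> (\<lambda>x. complex_of_real ((cmod (f x))\<^sup>2))"
    by (intro continuous_integrable continuous_intros f)
  then show "integrable \<omega> (\<lambda>x. (cmod (f x))\<^sup>2)"
    unfolding complex_of_real_integrable_eq .
qed

lemma integral_rotation:
  fixes f :: "real^'d \<Rightarrow> complex"
  assumes "h \<in> SO" "continuous_on (sphere 0 1) f"
  shows "(LINT x|\<omega>. f (h *v x)) = (LINT x|\<omega>. f x)"
proof -
  have "(\<lambda>x. h *v x) \<in> measurable (restrict_space borel (sphere 0 1)) (restrict_space borel (sphere 0 1))"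
    using assms(1) SO_sphere[OF assms(1)] by (intro measurable_restrict_space3 borel_measurable_continuous_onI)
      (auto intro!: linear_continuous_on matrix_vector_mul_bounded_linear)
  then have m: "(\<lambda>x. h *v x) \<in> measurable \<omega> \<omega>"
    using measurable_cong_sets[OF sets_\<omega> sets_\<omega>] by blast
  have "(LINT x|\<omega>. f x) = (LINT x|distr \<omega> \<omega> (\<lambda>x. h *v x). f x)"
    using assms(1) sphere_measure by (simp add: is_normalized_sphere_measure_def)
  also have "\<dots> = (LINT x|\<omega>. f (h *v x))"
    by (rule integral_distr[OF m continuous_measurable[OF assms(2)]])
  finally show ?thesis ..
qed

lemma L2_inner_cong:
  assumes "\<And>x. x \<in> sphere 0 1 \<Longrightarrow> f x = f' x" "\<And>x. x \<in> sphere 0 1 \<Longrightarrow> g x = g' x"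
  shows "L2_inner \<omega> f g = L2_inner \<omega> f' g'"
  unfolding L2_inner_def using assms by (intro Bochner_Integration.integral_cong) (auto simp: space_\<omega>)

lemma rot_action_continuous:
  fixes f :: "real^'d \<Rightarrow> complex"
  assumes "h \<in> SO" "continuous_on (sphere 0 1) f"
  shows "continuous_on (sphere 0 1) (rot_action h f)"
  unfolding rot_action_def
  by (rule continuous_on_compose2[OF assms(2)])
    (use SO_sphere[OF SO_matrix_inv(2)[OF assms(1)]] in
      \<open>auto intro!: linear_continuous_on matrix_vector_mul_bounded_linear\<close>)

lemma L2_inner_rot_action:
  assumes "h \<in> SO" "continuous_on (sphere 0 1) f" "continuous_on (sphere 0 1) g"
  shows "L2_inner \<omega> (rot_action h f) (rot_action h g) = L2_inner \<omega> f g"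
  unfolding L2_inner_def rot_action_def
  by (rule integral_rotation[OF SO_matrix_inv(2)[OF assms(1)]]) (intro continuous_intros assms)

lemma harmonic_obtain:
  assumes "v \<in> H n"
  obtains p where "p \<in> homogeneous_polys n" "\<And>x. laplacian p x = 0" "v = sphere_restrict p"
  using assms by (auto simp: sph_harmonics_def)

lemma harmonic_continuous: "v \<in> H n \<Longrightarrow> continuous_on (sphere 0 1) v"
proof (erule harmonic_obtain)
  fix p :: "real^'d \<Rightarrow> complex" assume "p \<in> homogeneous_polys n" "v = sphere_restrict p"
  then show ?thesis
    using polyfun_continuous[OF homogeneous_polyfun, of p n "sphere 0 1"]
    by (subst continuous_on_cong[OF refl, of _ _ p]) (auto simp: sphere_restrict_def)
qed

lemma harmonic_off_sphere: "v \<in> H n \<Longrightarrow> x \<notin> sphere 0 1 \<Longrightarrow> v x = 0"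
  by (auto simp: sph_harmonics_def sphere_restrict_def)

lemma harmonic_L2: "v \<in> H n \<Longrightarrow> v \<in> L2 \<omega>"
  by (intro continuous_L2 harmonic_continuous)

lemma harmonic_span: "H n = cfun_span (Y n ` I n)"
  using onb by (simp add: harmonic_onb_def)

lemma finite_I [simp]: "finite (I n)"
  using onb by (simp add: harmonic_onb_def)

lemma Y_harmonic: "k \<in> I n \<Longrightarrow> Y n k \<in> H n"
  unfolding harmonic_span by (intro cfun.span_base imageI)

lemmas Y_L2 = harmonic_L2[OF Y_harmonic]
lemmas Y_continuous = harmonic_continuous[OF Y_harmonic]

lemma Y_orthonormal: "k \<in> I n \<Longrightarrow> m \<in> I n \<Longrightarrow> L2_inner \<omega> (Y n k) (Y n m) = (if k = m then 1 else 0)"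
  using onb by (simp add: harmonic_onb_def)

lemma harmonic_zero: "(\<lambda>x. 0) \<in> H n"
  unfolding harmonic_span by (rule cfun_span_zero)

lemma harmonic_cmult: "v \<in> H n \<Longrightarrow> (\<lambda>x. c * v x) \<in> H n"
  unfolding harmonic_span by (rule cfun.span_scale)

lemma harmonic_add: "u \<in> H n \<Longrightarrow> v \<in> H n \<Longrightarrow> (\<lambda>x. u x + v x) \<in> H n"
  unfolding harmonic_span by (rule cfun_span_add)

lemma harmonic_diff: "u \<in> H n \<Longrightarrow> v \<in> H n \<Longrightarrow> (\<lambda>x. u x - v x) \<in> H n"
  using harmonic_add[of u n "\<lambda>x. -1 * v x"] harmonic_cmult[of v n "-1"] by simp

lemma harmonic_sum: "(\<And>a. a \<in> A \<Longrightarrow> f a \<in> H n) \<Longrightarrow> (\<lambda>x. \<Sum>a\<in>A. f a x) \<in> H n"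
  unfolding harmonic_span by (rule cfun_span_sum)

lemma harmonic_cnj: "v \<in> H n \<Longrightarrow> (\<lambda>x. cnj (v x)) \<in> H n"
proof (erule harmonic_obtain)
  fix p :: "real^'d \<Rightarrow> complex"
  assume p: "p \<in> homogeneous_polys n" "\<And>x. laplacian p x = 0" "v = sphere_restrict p"
  then have "(\<lambda>x. cnj (v x)) = sphere_restrict (\<lambda>x. cnj (p x))"
    by (auto simp: sphere_restrict_def)
  then show ?thesis
    using homogeneous_cnj[OF p(1)] laplacian_cnj[OF homogeneous_polyfun[OF p(1)]] p(2)
    unfolding sph_harmonics_def by force
qed

lemma harmonic_rot_action:
  assumes "v \<in> H n" "h \<in> SO"
  shows "rot_action h v \<in> H n"
  using assms(1)
proof (rule harmonic_obtain)
  fix p :: "real^'d \<Rightarrow> complex"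
  assume p: "p \<in> homogeneous_polys n" "\<And>x. laplacian p x = 0" "v = sphere_restrict p"
  let ?A = "matrix_inv h"
  have A: "?A ** transpose ?A = mat 1"
    using SO_matrix_inv[OF assms(2)] by simp
  have "rot_action h v = sphere_restrict (\<lambda>x. p (?A *v x))"
    using SO_norm[OF SO_matrix_inv(2)[OF assms(2)]]
    by (auto simp: p(3) rot_action_def sphere_restrict_def)
  then show ?thesis
    using homogeneous_matrix[OF p(1), of ?A] laplacian_rotation[OF homogeneous_polyfun[OF p(1)] A] p(2)
    unfolding sph_harmonics_def by force
qed

text \<open>The spanning property provides some coefficients and orthonormality identifies them. The
  identity holds at every point, not merely almost everywhere, which the pointwise kernel
  computations rely on.\<close>

lemma harmonic_expansion:
  assumes "v \<in> H n"
  shows "v x = (\<Sum>k\<in>I n. L2_inner \<omega> v (Y n k) * Y n k x)"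
proof -
  let ?T = "{v. \<exists>c. \<forall>x. v x = (\<Sum>k\<in>I n. c k * Y n k x)}"
  have "cfun.subspace ?T"
  proof (rule cfun_subspaceI)
    show "(\<lambda>x. 0) \<in> ?T" by (auto intro!: exI[of _ "\<lambda>_. 0"])
  next
    fix f g assume "f \<in> ?T" "g \<in> ?T"
    then obtain c d where "\<forall>x. f x = (\<Sum>k\<in>I n. c k * Y n k x)" "\<forall>x. g x = (\<Sum>k\<in>I n. d k * Y n k x)"
      by auto
    then show "(\<lambda>x. f x + g x) \<in> ?T"
      by (auto intro!: exI[of _ "\<lambda>k. c k + d k"] simp: distrib_right sum.distrib)
  next
    fix a f assume "f \<in> ?T"
    then obtain c where "\<forall>x. f x = (\<Sum>k\<in>I n. c k * Y n k x)" by auto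
    then show "(\<lambda>x. a * f x) \<in> ?T"
      by (auto intro!: exI[of _ "\<lambda>k. a * c k"] simp: sum_distrib_left mult.assoc)
  qed
  moreover have "Y n ` I n \<subseteq> ?T"
  proof safe
    fix m assume "m \<in> I n"
    then show "\<exists>c. \<forall>x. Y n m x = (\<Sum>k\<in>I n. c k * Y n k x)"
      by (intro exI[of _ "\<lambda>k. if k = m then 1 else 0"]) (simp add: if_distrib[of "\<lambda>y. y * _"] cong: if_cong)
  qed
  ultimately have "H n \<subseteq> ?T" unfolding harmonic_span by (intro cfun.span_minimal)
  then have "\<exists>c. \<forall>x. v x = (\<Sum>k\<in>I n. c k * Y n k x)" using assms by blast
  then obtain c where "\<forall>x. v x = (\<Sum>k\<in>I n. c k * Y n k x)" ..
  then have c: "v = (\<lambda>x. \<Sum>k\<in>I n. c k * Y n k x)" by (simp add: fun_eq_iff)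
  have "L2_inner \<omega> v (Y n m) = c m" if m: "m \<in> I n" for m
  proof -
    have "L2_inner \<omega> v (Y n m) = (\<Sum>k\<in>I n. c k * L2_inner \<omega> (Y n k) (Y n m))"
      unfolding c by (subst L2_inner_sum_left) (auto intro: L2_cmult Y_L2 m simp: L2_inner_cmult_left)
    also have "\<dots> = (\<Sum>k\<in>I n. if k = m then c k else 0)"
      using m by (intro sum.cong) (auto simp: Y_orthonormal)
    finally show ?thesis using m by simp
  qed
  then show ?thesis by (simp add: c)
qed

lemma harmonic_parseval:
  assumes "v \<in> H n"
  shows "of_real (\<Sum>k\<in>I n. (cmod (L2_inner \<omega> v (Y n k)))\<^sup>2) = L2_inner \<omega> v v"
proof -
  have "L2_inner \<omega> v v = L2_inner \<omega> (\<lambda>x. \<Sum>k\<in>I n. L2_inner \<omega> v (Y n k) * Y n k x) v"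
    using harmonic_expansion[OF assms] by (intro L2_inner_cong) auto
  also have "\<dots> = (\<Sum>k\<in>I n. L2_inner \<omega> v (Y n k) * L2_inner \<omega> (Y n k) v)"
    by (subst L2_inner_sum_left) (auto intro: L2_cmult Y_L2 harmonic_L2 assms simp: L2_inner_cmult_left)
  also have "\<dots> = (\<Sum>k\<in>I n. L2_inner \<omega> v (Y n k) * cnj (L2_inner \<omega> v (Y n k)))"
    by (intro sum.cong refl arg_cong2[of _ _ _ _ "(*)"] L2_inner_cnj)
  finally show ?thesis
    by (simp only: of_real_sum complex_norm_square)
qed

section \<open>Reproducing kernels of the spaces of harmonics\<close>

definition Z :: "nat \<Rightarrow> real^'d \<Rightarrow> real^'d \<Rightarrow> complex" where
  "Z n x y = (\<Sum>k\<in>I n. Y n k x * cnj (Y n k y))"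

lemma Z_harmonic: "(\<lambda>x. Z n x y) \<in> H n"
  unfolding Z_def by (subst mult.commute) (intro harmonic_sum harmonic_cmult Y_harmonic)

lemma Z_cnj: "Z n y x = cnj (Z n x y)"
  by (simp add: Z_def mult.commute)

lemma Z_reproducing:
  assumes "v \<in> H n"
  shows "L2_inner \<omega> v (\<lambda>x. Z n x y) = v y"
proof -
  have "L2_inner \<omega> (\<lambda>x. Z n x y) v = (\<Sum>k\<in>I n. L2_inner \<omega> (\<lambda>x. cnj (Y n k y) * Y n k x) v)"
    unfolding Z_def mult.commute[of "Y n _ _"]
    by (intro L2_inner_sum_left L2_cmult Y_L2 harmonic_L2[OF assms])
  then have "L2_inner \<omega> v (\<lambda>x. Z n x y) = cnj (\<Sum>k\<in>I n. cnj (Y n k y) * L2_inner \<omega> (Y n k) v)"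
    by (subst L2_inner_cnj) (simp add: L2_inner_cmult_left)
  also have "\<dots> = (\<Sum>k\<in>I n. L2_inner \<omega> v (Y n k) * Y n k y)"
    by (simp add: L2_inner_cnj[of \<omega> v] mult.commute)
  finally show ?thesis using harmonic_expansion[OF assms, of y] by simp
qed

text \<open>Both sides, as functions of \<open>x\<close>, lie in \<open>H n\<close>. By the
  reproducing property and the invariance of the inner product they have the same coefficients in
  the basis.\<close>

lemma Z_rotation:
  assumes h: "h \<in> SO"
  shows "Z n (h *v x) (h *v y) = Z n x y"
proof -
  define u where "u x = Z n (h *v x) (h *v y)" for x
  have u_eq: "u = rot_action (matrix_inv h) (\<lambda>x. Z n x (h *v y))"
    by (simp add: u_def[abs_def] rot_action_def SO_matrix_inv_inv h)
  have u: "u \<in> H n"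
    unfolding u_eq by (intro harmonic_rot_action Z_harmonic SO_matrix_inv h)
  have "L2_inner \<omega> u (Y n k) = cnj (Y n k y)" if k: "k \<in> I n" for k
  proof -
    have "Y n k = rot_action (matrix_inv h) (rot_action h (Y n k))"
      by (simp add: rot_action_def SO_matrix_inv_inv h)
    then have "L2_inner \<omega> (Y n k) u =
        L2_inner \<omega> (rot_action (matrix_inv h) (rot_action h (Y n k))) (rot_action (matrix_inv h) (\<lambda>x. Z n x (h *v y)))"
      unfolding u_eq by simp
    also have "\<dots> = L2_inner \<omega> (rot_action h (Y n k)) (\<lambda>x. Z n x (h *v y))"
      by (intro L2_inner_rot_action SO_matrix_inv h harmonic_continuous[OF Z_harmonic]
          rot_action_continuous Y_continuous k)
    also have "\<dots> = rot_action h (Y n k) (h *v y)"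
      by (intro Z_reproducing harmonic_rot_action Y_harmonic k h)
    finally show ?thesis by (subst L2_inner_cnj) (simp add: rot_action_def h)
  qed
  then have "u x = (\<Sum>k\<in>I n. cnj (Y n k y) * Y n k x)" using harmonic_expansion[OF u, of x] by simp
  then show ?thesis by (simp add: u_def Z_def mult.commute)
qed

text \<open>A zero at one point of the diagonal would spread by rotations to all of it. There the
  kernel is the sum of the squared moduli of the basis functions, so these would vanish on the
  sphere in spite of having norm 1.\<close>

lemma Z_diagonal_nonzero:
  assumes "I n \<noteq> {}" "x \<in> sphere 0 1"
  shows "Z n x x \<noteq> 0"
proof
  assume 0: "Z n x x = 0"
  obtain k where k: "k \<in> I n" using assms(1) by auto
  have "Y n k y = 0" if y: "y \<in> sphere 0 1" for y
  proof -
    obtain h where "h \<in> SO" "h *v x = y"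
      using SO_maps_pair[OF card_dim, of x y x y] assms(2) y by (auto simp: dot_square_norm)
    then have "Z n y y = 0" using 0 Z_rotation by metis
    moreover have "Z n y y = of_real (\<Sum>k\<in>I n. (cmod (Y n k y))\<^sup>2)"
      by (simp only: Z_def of_real_sum complex_norm_square)
    ultimately have "(\<Sum>k\<in>I n. (cmod (Y n k y))\<^sup>2) = 0" by (metis of_real_eq_0_iff)
    then show ?thesis using k by (simp add: sum_nonneg_eq_0_iff)
  qed
  then have "L2_inner \<omega> (Y n k) (Y n k) = L2_inner \<omega> (\<lambda>x. 0) (\<lambda>x. 0)" by (intro L2_inner_cong)
  then show False using Y_orthonormal[OF k k] by (simp add: L2_inner_def)
qed

text \<open>Any point of the sphere becomes the pole after a rotation, which preserves both spaces,
  so \<open>harmonic_degree_unique\<close> applies everywhere.\<close>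

lemma harmonic_disjoint:
  assumes "v \<in> H m" "v \<in> H n" "m \<noteq> n"
  shows "v x = 0"
proof (cases "x \<in> sphere 0 1")
  case True
  fix i :: 'd
  obtain h where h: "h \<in> SO" "h *v axis i 1 = x"
    using SO_maps_pair[OF card_dim, of "axis i 1" x "axis i 1" x] True by (auto simp: dot_square_norm)
  let ?u = "rot_action (matrix_inv h) v"
  have "?u \<in> H m" "?u \<in> H n" using assms h by (auto intro: harmonic_rot_action SO_matrix_inv)
  then obtain p q where pq: "p \<in> homogeneous_polys m" "\<And>x. laplacian p x = 0" "?u = sphere_restrict p"
     "q \<in> homogeneous_polys n" "\<And>x. laplacian q x = 0" "?u = sphere_restrict q"
    by (metis harmonic_obtain)
  have "p x = q x" if "norm x = 1" for x
    using fun_cong[OF pq(3), of x] fun_cong[OF pq(6), of x] that by (simp add: sphere_restrict_def)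
  then have "p (axis i 1) = 0"
    using card_dim by (intro harmonic_degree_unique[OF _ pq(1,2,4,5) _ assms(3)]) auto
  then have "?u (axis i 1) = 0" by (simp add: pq(3) sphere_restrict_def)
  then show ?thesis using h by (simp add: rot_action_def SO_matrix_inv_inv)
qed (use harmonic_off_sphere assms in auto)

text \<open>Transfers \<open>zonal_harmonic_zero\<close> to the sphere: homogeneity extends zonality
  from unit vectors to all vectors of equal norm.\<close>

lemma zonal_zero:
  assumes v: "v \<in> H n"
    and zonal: "\<And>x y. x \<in> sphere 0 1 \<Longrightarrow> y \<in> sphere 0 1 \<Longrightarrow> x $ i = y $ i \<Longrightarrow> v x = v y"
    and pole: "v (axis i 1) = 0"
  shows "v x = 0"
  using v
proof (rule harmonic_obtain)
  fix p :: "real^'d \<Rightarrow> complex"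
  assume p: "p \<in> homogeneous_polys n" "\<And>x. laplacian p x = 0" "v = sphere_restrict p"
  have "p x = p y" if xy: "norm x = norm y" "x $ i = y $ i" for x y
  proof (cases "x = 0")
    case False
    then have y: "y \<noteq> 0" using xy by auto
    have polar: "p x = of_real (norm x ^ n) * v (x /\<^sub>R norm x)" if "x \<noteq> 0" for x
      using homogeneous_scaleR[OF p(1), of "norm x" "x /\<^sub>R norm x"] that
      by (simp add: p(3) sphere_restrict_def)
    have "v (x /\<^sub>R norm x) = v (y /\<^sub>R norm y)"
      using False y xy by (intro zonal) simp_all
    then show ?thesis using polar[OF False] polar[OF y] xy by simp
  qed (use xy in auto)
  note p_zonal = this
  have "p x = 0" for x
  proof (rule zonal_harmonic_zero[OF card_dim p(1,2)])
    show "p (axis i 1) = 0" using pole by (simp add: p(3) sphere_restrict_def)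
    show "p x = p y" if "norm x = norm y" "x $ i = y $ i" for x y by (rule p_zonal[OF that])
  qed
  then show ?thesis by (simp add: p(3) sphere_restrict_def)
qed

text \<open>
  Composing \<open>B\<close> with the projection onto \<open>H n\<close> gives a kernel \<open>C\<close> that only depends on
  the inner product of its arguments, hence is symmetric. This puts its sections into \<open>H n\<close>,
  where zonal functions are unique up to scalars, so that \<open>C\<close> is a multiple of \<open>Z n\<close>.
\<close>

lemma invariant_kernel_scalar:
  assumes cont: "\<And>x. x \<in> sphere 0 1 \<Longrightarrow> continuous_on (sphere 0 1) (B x)"
    and inv: "\<And>h x y. h \<in> SO \<Longrightarrow> x \<in> sphere 0 1 \<Longrightarrow> y \<in> sphere 0 1 \<Longrightarrow> B (h *v x) (h *v y) = B x y"
  obtains c where "\<And>v x. v \<in> H n \<Longrightarrow> x \<in> sphere 0 1 \<Longrightarrow> (LINT y|\<omega>. B x y * v y) = c * v x"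
proof (cases "I n = {}")
  case True
  then have "v = (\<lambda>x. 0)" if "v \<in> H n" for v using harmonic_expansion[OF that] by auto
  then have "(LINT y|\<omega>. B x y * v y) = 0 * v x" if "v \<in> H n" for v x
    using that by fastforce
  then show ?thesis by (rule that)
next
  case False
  \<comment> \<open>The function \<open>a k\<close> is the image of \<open>Y n k\<close> under
    \<open>B\<close>; nothing so far places it in \<open>H n\<close>, which is the difficulty of the
    proof.\<close>
  define a where "a k x = (LINT y|\<omega>. B x y * Y n k y)" for k x
  define C where "C x z = (\<Sum>k\<in>I n. a k x * cnj (Y n k z))" for x z
  have int: "(LINT y|\<omega>. B x y * (\<Sum>k\<in>I n. c k * Y n k y)) = (\<Sum>k\<in>I n. a k x * c k)"
    if "x \<in> sphere 0 1" for x c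
  proof -
    have "(LINT y|\<omega>. B x y * (\<Sum>k\<in>I n. c k * Y n k y)) = (LINT y|\<omega>. (\<Sum>k\<in>I n. B x y * Y n k y * c k))"
      by (simp add: sum_distrib_left mult_ac)
    also have "\<dots> = (\<Sum>k\<in>I n. (LINT y|\<omega>. B x y * Y n k y * c k))"
      by (intro Bochner_Integration.integral_sum continuous_integrable continuous_intros cont Y_continuous that)
    finally show ?thesis by (simp add: a_def)
  qed
  have C_int: "C x z = (LINT y|\<omega>. B x y * Z n y z)" if "x \<in> sphere 0 1" for x z
    using int[OF that, of "\<lambda>k. cnj (Y n k z)"] by (simp add: C_def Z_def mult.commute)
  have C_rot: "C (h *v x) (h *v z) = C x z" if "h \<in> SO" "x \<in> sphere 0 1" "z \<in> sphere 0 1" for h x z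
  proof -
    have "C (h *v x) (h *v z) = (LINT y|\<omega>. B (h *v x) y * Z n y (h *v z))"
      using that by (intro C_int) simp
    also have "\<dots> = (LINT y|\<omega>. B (h *v x) (h *v y) * Z n (h *v y) (h *v z))"
      using that cont
      by (intro integral_rotation[symmetric] continuous_intros harmonic_continuous[OF Z_harmonic]) auto
    also have "\<dots> = (LINT y|\<omega>. B x y * Z n y z)"
      using that by (intro Bochner_Integration.integral_cong) (auto simp: space_\<omega> inv Z_rotation)
    finally show ?thesis using C_int that by simp
  qed
  have pairs: "K x z = K x' z'"
    if K: "\<And>h x z. h \<in> SO \<Longrightarrow> x \<in> sphere 0 1 \<Longrightarrow> z \<in> sphere 0 1 \<Longrightarrow> K (h *v x) (h *v z) = K x z"
      and xz: "x \<in> sphere 0 1" "z \<in> sphere 0 1" "x' \<in> sphere 0 1" "z' \<in> sphere 0 1" "x \<bullet> z = x' \<bullet> z'"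
    for K :: "real^'d \<Rightarrow> real^'d \<Rightarrow> complex" and x z x' z'
  proof -
    obtain h where "h \<in> SO" "h *v x = x'" "h *v z = z'"
      using SO_maps_pair[OF card_dim, of x x' z z'] xz by auto
    then show ?thesis using K[of h x z] xz by simp
  qed
  fix i :: 'd
  define e :: "real^'d" where "e = axis i 1"
  have e: "e \<in> sphere 0 1" by (simp add: e_def)
  \<comment> \<open>The section of \<open>C\<close> in its second argument, with the pole as first
    argument. It is a combination of conjugated basis functions and hence in \<open>H n\<close> by
    construction; symmetry of \<open>C\<close> carries this over to the section in the first
    argument.\<close>
  define f where "f x = (\<Sum>k\<in>I n. a k e * cnj (Y n k x))" for x
  have f: "f \<in> H n"
    unfolding f_def by (intro harmonic_sum harmonic_cmult harmonic_cnj Y_harmonic)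
  have fC: "f x = C x e" if "x \<in> sphere 0 1" for x
  proof -
    have "C x e = C e x"
      by (rule pairs[of C, OF C_rot]) (use that e in \<open>simp_all add: inner_commute\<close>)
    then show ?thesis by (simp add: f_def C_def)
  qed
  \<comment> \<open>Normalized so that \<open>u\<close> below vanishes at the pole, as
    \<open>zonal_zero\<close> demands.\<close>
  define c where "c = C e e / Z n e e"
  define u where "u x = f x - c * Z n x e" for x
  have u: "u \<in> H n" unfolding u_def by (intro harmonic_diff f harmonic_cmult Z_harmonic)
  have "u x = 0" for x
  proof (rule zonal_zero[OF u])
    show "u (axis i 1) = 0"
      using Z_diagonal_nonzero[OF False e] fC[OF e] by (simp add: u_def c_def flip: e_def)
    fix x y :: "real^'d" assume xy: "x \<in> sphere 0 1" "y \<in> sphere 0 1" "x $ i = y $ i"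
    then have "x \<bullet> e = y \<bullet> e" by (simp add: e_def inner_axis)
    have "C x e = C y e"
      by (rule pairs[of C, OF C_rot]) (use xy e \<open>x \<bullet> e = y \<bullet> e\<close> in simp_all)
    moreover have "Z n x e = Z n y e"
      by (rule pairs[of "Z n", OF Z_rotation]) (use xy e \<open>x \<bullet> e = y \<bullet> e\<close> in simp_all)
    ultimately show "u x = u y" using fC xy by (simp add: u_def)
  qed
  then have Ce: "C x e = c * Z n x e" if "x \<in> sphere 0 1" for x
    using fC[OF that] by (simp add: u_def)
  have CZ: "C x z = c * Z n x z" if xz: "x \<in> sphere 0 1" "z \<in> sphere 0 1" for x z
  proof -
    obtain h where h: "h \<in> SO" "h *v z = e"
      using SO_maps_pair[OF card_dim, of z e z e] xz e by (auto simp: dot_square_norm)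
    have "C x z = C (h *v x) e" using C_rot[of h x z] h xz by simp
    also have "\<dots> = c * Z n (h *v x) e" using Ce[of "h *v x"] SO_sphere[OF h(1)] xz by simp
    also have "Z n (h *v x) e = Z n x z" using Z_rotation[of h n x z] h by simp
    finally show ?thesis .
  qed
  \<comment> \<open>The numbers \<open>a k x\<close> are the conjugated basis coefficients of
    \<open>C x\<close>, so the identity of kernels translates back into the action of
    \<open>B\<close> on each basis function.\<close>
  have a: "a k x = c * Y n k x" if k: "k \<in> I n" and x: "x \<in> sphere 0 1" for k x
  proof -
    have "(LINT z|\<omega>. C x z * Y n k z) = L2_inner \<omega> (Y n k) (\<lambda>z. cnj (C x z))"
      by (simp add: L2_inner_def mult.commute)
    also have "\<dots> = cnj (L2_inner \<omega> (\<lambda>z. \<Sum>l\<in>I n. cnj (a l x) * Y n l z) (Y n k))"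
      by (subst L2_inner_cnj) (simp add: C_def)
    also have "\<dots> = (\<Sum>l\<in>I n. a l x * cnj (L2_inner \<omega> (Y n l) (Y n k)))"
      by (subst L2_inner_sum_left) (auto intro: L2_cmult Y_L2 k simp: L2_inner_cmult_left)
    also have "\<dots> = (\<Sum>l\<in>I n. if l = k then a l x else 0)"
      using k by (intro sum.cong) (auto simp: Y_orthonormal)
    also have "\<dots> = a k x" using k by simp
    finally have "a k x = (LINT z|\<omega>. C x z * Y n k z)" ..
    also have "\<dots> = (LINT z|\<omega>. c * (Y n k z * cnj (Z n z x)))"
      using x by (intro Bochner_Integration.integral_cong) (auto simp: space_\<omega> CZ Z_cnj[of n x] mult_ac)
    also have "\<dots> = c * L2_inner \<omega> (Y n k) (\<lambda>z. Z n z x)"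
      unfolding L2_inner_def by (rule Bochner_Integration.integral_mult_right_zero)
    also have "\<dots> = c * Y n k x" by (simp add: Z_reproducing Y_harmonic k)
    finally show ?thesis .
  qed
  have "(LINT y|\<omega>. B x y * v y) = c * v x" if v: "v \<in> H n" and x: "x \<in> sphere 0 1" for v x
  proof -
    have "(LINT y|\<omega>. B x y * v y) = (\<Sum>k\<in>I n. a k x * L2_inner \<omega> v (Y n k))"
      unfolding int[OF x, symmetric] harmonic_expansion[OF v, symmetric] ..
    also have "\<dots> = c * (\<Sum>k\<in>I n. L2_inner \<omega> v (Y n k) * Y n k x)"
      unfolding sum_distrib_left by (intro sum.cong refl) (simp add: a[OF _ x])
    finally show ?thesis by (simp flip: harmonic_expansion[OF v])
  qed
  then show ?thesis by (rule that)
qed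

text \<open>The projection \<open>w\<close> of \<open>v\<close> onto \<open>H m\<close> is a
  multiple of \<open>v\<close>, hence lies in both spaces of harmonics and vanishes by
  \<open>harmonic_disjoint\<close>. Thus all coefficients of \<open>v\<close> of degree
  \<open>m\<close> are 0.\<close>

lemma harmonic_orthogonal:
  assumes u: "u \<in> H m" and v: "v \<in> H n" and ne: "m \<noteq> n"
  shows "L2_inner \<omega> u v = 0"
proof -
  have cont: "continuous_on (sphere 0 1) (Z m x)" for x
    using harmonic_continuous[OF harmonic_cnj[OF Z_harmonic[of m x]]] by (simp flip: Z_cnj)
  obtain c where c: "\<And>v x. v \<in> H n \<Longrightarrow> x \<in> sphere 0 1 \<Longrightarrow> (LINT y|\<omega>. Z m x y * v y) = c * v x"
    by (rule invariant_kernel_scalar[of "Z m" n]) (rule cont, erule Z_rotation, rule that, blast)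
  define w where "w x = (\<Sum>k\<in>I m. L2_inner \<omega> v (Y m k) * Y m k x)" for x
  have w: "w \<in> H m" unfolding w_def by (intro harmonic_sum harmonic_cmult Y_harmonic)
  have "w x = (LINT y|\<omega>. Z m x y * v y)" for x
  proof -
    have "(LINT y|\<omega>. Z m x y * v y) = (LINT y|\<omega>. (\<Sum>k\<in>I m. v y * cnj (Y m k y) * Y m k x))"
      by (simp add: Z_def sum_distrib_left mult_ac)
    also have "\<dots> = (\<Sum>k\<in>I m. (LINT z|\<omega>. v z * cnj (Y m k z) * Y m k x))"
      by (intro Bochner_Integration.integral_sum continuous_integrable continuous_intros
          harmonic_continuous[OF v] Y_continuous)
    finally show ?thesis by (simp add: w_def L2_inner_def)
  qed
  then have wc: "w x = c * v x" if "x \<in> sphere 0 1" for x using c[OF v that] by simp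
  then have wc': "w = (\<lambda>x. c * v x)"
    using harmonic_off_sphere[OF w] harmonic_off_sphere[OF v] by (intro ext) (metis mult_zero_right)
  have w0: "w x = 0" for x
    by (rule harmonic_disjoint[OF w _ ne]) (simp add: wc' harmonic_cmult v)
  have "L2_inner \<omega> v (Y m k) = 0" if k: "k \<in> I m" for k
  proof -
    have "0 = L2_inner \<omega> w (Y m k)" using w0 by (simp add: L2_inner_def)
    also have "\<dots> = (\<Sum>l\<in>I m. L2_inner \<omega> v (Y m l) * L2_inner \<omega> (Y m l) (Y m k))"
      unfolding w_def
      by (subst L2_inner_sum_left) (auto intro: L2_cmult Y_L2 k simp: L2_inner_cmult_left)
    also have "\<dots> = (\<Sum>l\<in>I m. if l = k then L2_inner \<omega> v (Y m l) else 0)"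
      using k by (intro sum.cong) (auto simp: Y_orthonormal)
    finally show ?thesis using k by simp
  qed
  then have "L2_inner \<omega> (Y m k) v = 0" if "k \<in> I m" for k
    using that by (subst L2_inner_cnj) simp
  then have "L2_inner \<omega> (\<lambda>x. \<Sum>k\<in>I m. L2_inner \<omega> u (Y m k) * Y m k x) v = 0"
    by (subst L2_inner_sum_left) (auto intro: L2_cmult Y_L2 harmonic_L2 v simp: L2_inner_cmult_left)
  then show ?thesis by (simp flip: harmonic_expansion[OF u])
qed

end

section \<open>Blocks of the frame operator\<close>

context spherical_onb
begin

text \<open>Padding the components by 0 above \<open>N\<close> lets later statements quantify over
  all degrees.\<close>

lemma sph_polys_obtain:
  fixes P :: "real^'d \<Rightarrow> complex"
  assumes "P \<in> sph_polys N"
  obtains h where "\<And>n. h n \<in> H n" "\<And>n. n > N \<Longrightarrow> h n = (\<lambda>x. 0)" "P = (\<lambda>x. \<Sum>n\<le>N. h n x)"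
proof -
  obtain h where h: "\<And>n. n \<le> N \<Longrightarrow> h n \<in> H n" "P = (\<lambda>x. \<Sum>n\<le>N. h n x)"
    using assms by (auto simp: sph_polys_def)
  show ?thesis
    by (rule that[of "\<lambda>n. if n \<le> N then h n else (\<lambda>x. 0)"]) (auto simp: h harmonic_zero)
qed

lemma sph_polys_continuous: "P \<in> sph_polys N \<Longrightarrow> continuous_on (sphere 0 1) P"
  for P :: "real^'d \<Rightarrow> complex"
  by (erule sph_polys_obtain) (simp, rule continuous_on_sum, rule harmonic_continuous, blast)

lemma sph_polys_cnj:
  fixes P :: "real^'d \<Rightarrow> complex"
  assumes "P \<in> sph_polys N"
  shows "(\<lambda>x. cnj (P x)) \<in> sph_polys N"
proof -
  obtain h where h: "\<And>n. h n \<in> H n" "\<And>n. n > N \<Longrightarrow> h n = (\<lambda>x. 0)" "P = (\<lambda>x. \<Sum>n\<le>N. h n x)"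
    using assms by (rule sph_polys_obtain) (rule that)
  then show ?thesis
    using harmonic_cnj[OF h(1)]
    unfolding sph_polys_def by (auto intro!: exI[of _ "\<lambda>n x. cnj (h n x)"])
qed

lemma sph_polys_one: "(sphere_restrict (\<lambda>x. 1) :: real^'d \<Rightarrow> complex) \<in> sph_polys N"
proof -
  have "laplacian (\<lambda>x. 1) x = 0" for x :: "real^'d"
    by (simp add: laplacian_def partial_deriv_def[abs_def])
  then have one: "sphere_restrict (\<lambda>x. 1) \<in> H 0"
    using homogeneous_one unfolding sph_harmonics_def by blast
  have "(sphere_restrict (\<lambda>x. 1) :: real^'d \<Rightarrow> complex) = (\<lambda>x. \<Sum>n\<le>N. (if n = 0 then sphere_restrict (\<lambda>x. 1) else (\<lambda>x. 0)) x)"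
    by (auto simp: if_distrib[of "\<lambda>f. f _"] cong: if_cong)
  then show ?thesis
    unfolding sph_polys_def using one harmonic_zero
    by (auto intro!: exI[of _ "\<lambda>n. if n = 0 then sphere_restrict (\<lambda>x. 1) else (\<lambda>x. 0)"])
qed

text \<open>Orthogonality removes the components of other degrees; if \<open>n\<close> exceeds
  \<open>N\<close>, the padding makes both sides 0.\<close>

lemma sum_components_inner:
  assumes h: "\<And>n. h n \<in> H n" and zero: "\<And>n. n > N \<Longrightarrow> h n = (\<lambda>x. 0)" and v: "v \<in> H n"
  shows "L2_inner \<omega> (\<lambda>x. \<Sum>m\<le>N. h m x) v = L2_inner \<omega> (h n) v"
proof -
  have "L2_inner \<omega> (\<lambda>x. \<Sum>m\<le>N. h m x) v = (\<Sum>m\<le>N. L2_inner \<omega> (h m) v)"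
    by (intro L2_inner_sum_left harmonic_L2[OF h] harmonic_L2[OF v])
  also have "\<dots> = (\<Sum>m\<le>N. if m = n then L2_inner \<omega> (h n) v else 0)"
    by (intro sum.cong refl) (auto intro: harmonic_orthogonal h v)
  also have "\<dots> = L2_inner \<omega> (h n) v"
    using zero[of n] by (auto simp: L2_inner_def not_le)
  finally show ?thesis .
qed

text \<open>At a fixed point \<open>x\<close> the rotated polynomial is viewed as a function of the
  rotation. Expanding \<open>P\<close>, and then each rotated basis function within its own degree,
  exhibits it as a combination of matrix coefficients. Agreement on \<open>SO\<close> suffices,
  since the integral and the nodes see nothing else.\<close>

lemma rot_action_coeff_space:
  fixes P :: "real^'d \<Rightarrow> complex"
  assumes P: "P \<in> sph_polys N"
  obtains f where "f \<in> coeff_space \<omega> I Y N" "\<And>g. g \<in> SO \<Longrightarrow> f g = rot_action g P x"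
proof -
  obtain h where h: "\<And>n. h n \<in> H n" "\<And>n. n > N \<Longrightarrow> h n = (\<lambda>x. 0)" "P = (\<lambda>x. \<Sum>n\<le>N. h n x)"
    using P by (rule sph_polys_obtain) (rule that)
  define f where "f g = (\<Sum>n\<le>N. \<Sum>m\<in>I n. \<Sum>k\<in>I n.
    (L2_inner \<omega> (h n) (Y n m) * Y n k x) * matrix_coeff \<omega> Y n k m g)" for g
  have "f \<in> coeff_space \<omega> I Y N"
    unfolding f_def coeff_space_def by (intro cfun_span_sum cfun.span_scale cfun.span_base) auto
  moreover have "f g = rot_action g P x" if g: "g \<in> SO" for g
  proof -
    have Yexp: "rot_action g (Y n m) x = (\<Sum>k\<in>I n. matrix_coeff \<omega> Y n k m g * Y n k x)" if "m \<in> I n" for n m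
      unfolding matrix_coeff_def by (intro harmonic_expansion harmonic_rot_action Y_harmonic that g)
    have "rot_action g P x = (\<Sum>n\<le>N. \<Sum>m\<in>I n. L2_inner \<omega> (h n) (Y n m) * rot_action g (Y n m) x)"
      unfolding h(3) rot_action_def by (intro sum.cong refl harmonic_expansion h)
    also have "\<dots> = f g"
      unfolding f_def by (intro sum.cong refl) (simp add: Yexp sum_distrib_left mult_ac)
    finally show ?thesis ..
  qed
  ultimately show ?thesis by (rule that)
qed

text \<open>The quadrature rule is bilinear without conjugation, so the conjugate of the second
  factor is treated as the rotated polynomial \<open>cnj P\<close>, which has the same degree
  bound.\<close>

lemma quadrature_kernel:
  fixes P :: "real^'d \<Rightarrow> complex"
  assumes Q: "quadrature_exact \<mu> (coeff_space \<omega> I Y N) R w g" and g: "\<And>r. r \<in> {1..R} \<Longrightarrow> g r \<in> SO"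
    and \<mu>: "is_normalized_Haar_SO \<mu>" and P: "P \<in> sph_polys N"
  shows "(\<Sum>r=1..R. of_real (w r) * rot_action (g r) P x * cnj (rot_action (g r) P y)) =
    (LINT h|\<mu>. rot_action h P x * cnj (rot_action h P y))"
proof -
  obtain f1 where f1: "f1 \<in> coeff_space \<omega> I Y N" "\<And>g. g \<in> SO \<Longrightarrow> f1 g = rot_action g P x"
    by (rule rot_action_coeff_space[OF P, where x = x]) (rule that)
  obtain f2 where f2: "f2 \<in> coeff_space \<omega> I Y N" "\<And>g. g \<in> SO \<Longrightarrow> f2 g = rot_action g (\<lambda>x. cnj (P x)) y"
    by (rule rot_action_coeff_space[OF sph_polys_cnj[OF P], where x = y]) (rule that)
  have space: "space \<mu> = SO" using \<mu> by (simp add: is_normalized_Haar_SO_def)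
  have "(\<Sum>r=1..R. of_real (w r) * rot_action (g r) P x * cnj (rot_action (g r) P y)) =
      (\<Sum>r=1..R. of_real (w r) * f1 (g r) * f2 (g r))"
    using g by (intro sum.cong refl) (simp add: f1 f2 rot_action_def)
  also have "\<dots> = (LINT h|\<mu>. f1 h * f2 h)"
    using Q f1(1) f2(1) by (simp add: quadrature_exact_def)
  also have "\<dots> = (LINT h|\<mu>. rot_action h P x * cnj (rot_action h P y))"
    by (intro Bochner_Integration.integral_cong refl) (simp add: space f1 f2, simp add: rot_action_def)
  finally show ?thesis .
qed

text \<open>Exactness is tested on the constant function 1 of the group, realized as the rotated
  constant harmonic at a point.\<close>

lemma quadrature_weights_sum:
  assumes Q: "quadrature_exact \<mu> (coeff_space \<omega> I Y N) R w g" and g: "\<And>r. r \<in> {1..R} \<Longrightarrow> g r \<in> SO"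
    and \<mu>: "is_normalized_Haar_SO \<mu>"
  shows "(\<Sum>r=1..R. w r) = 1"
proof -
  fix i :: 'd
  let ?x = "axis i 1 :: real^'d"
  have one: "rot_action h (sphere_restrict (\<lambda>x. 1)) ?x = 1" if "h \<in> SO" for h :: "real^'d^'d"
    using SO_norm[OF SO_matrix_inv(2)[OF that]] by (simp add: rot_action_def sphere_restrict_def)
  have "(\<Sum>r=1..R. of_real (w r)) = (LINT h|\<mu>. (1::complex))"
  proof -
    have "(\<Sum>r=1..R. of_real (w r)) = (\<Sum>r=1..R. of_real (w r) *
        rot_action (g r) (sphere_restrict (\<lambda>x. 1)) ?x * cnj (rot_action (g r) (sphere_restrict (\<lambda>x. 1)) ?x))"
      using g by (intro sum.cong refl) (simp add: one)
    also have "\<dots> = (LINT h|\<mu>. rot_action h (sphere_restrict (\<lambda>x. 1)) ?x *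
        cnj (rot_action h (sphere_restrict (\<lambda>x. 1)) ?x))"
      by (rule quadrature_kernel[OF Q g \<mu> sph_polys_one])
    also have "\<dots> = (LINT h|\<mu>. 1)"
      using \<mu> by (intro Bochner_Integration.integral_cong refl) (simp add: one is_normalized_Haar_SO_def)
    finally show ?thesis .
  qed
  also have "\<dots> = 1" using \<mu> by (simp add: is_normalized_Haar_SO_def measure_def)
  finally show ?thesis by (metis of_real_eq_1_iff of_real_sum)
qed

text \<open>Evaluating T(h) P at k x is evaluating T(k^-1 h) P at x, so the claim is left invariance
  of the measure; the remaining work is measurability.\<close>

lemma Haar_kernel_invariant:
  fixes P :: "real^'d \<Rightarrow> complex"
  assumes \<mu>: "is_normalized_Haar_SO \<mu>" and P: "continuous_on (sphere 0 1) P"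
    and k: "k \<in> SO" and xy: "x \<in> sphere 0 1" "y \<in> sphere 0 1"
  shows "(LINT h|\<mu>. rot_action h P (k *v x) * cnj (rot_action h P (k *v y))) =
    (LINT h|\<mu>. rot_action h P x * cnj (rot_action h P y))"
proof -
  define F where "F h = rot_action h P x * cnj (rot_action h P y)" for h
  define k' where "k' = matrix_inv k"
  have k': "k' \<in> SO" unfolding k'_def by (rule SO_matrix_inv(2)[OF k])
  have space: "space \<mu> = SO" and sets: "sets \<mu> = sets (restrict_space borel SO)"
    and inv: "distr \<mu> \<mu> (\<lambda>g. k' ** g) = \<mu>"
    using \<mu> k' by (auto simp: is_normalized_Haar_SO_def)
  have cont: "continuous_on SO (\<lambda>h. rot_action h P z)" if z: "z \<in> sphere 0 1" for z
  proof -
    \<comment> \<open>\<open>matrix_inv\<close> is defined by a choice, so continuity is read off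
      the transpose, which agrees with it on \<open>SO\<close>.\<close>
    have "continuous_on SO (\<lambda>h. P (transpose h *v z))"
    proof (rule continuous_on_compose2[OF P])
      show "continuous_on SO (\<lambda>h::real^'d^'d. transpose h *v z)"
        unfolding transpose_def matrix_vector_mult_def by (intro continuous_intros)
      show "(\<lambda>h::real^'d^'d. transpose h *v z) ` SO \<subseteq> sphere 0 1"
        using SO_sphere[OF SO_matrix_inv(2)] z by (auto simp del: mem_sphere simp: SO_matrix_inv(1) simp flip: transpose_matrix_vector)
    qed
    then show ?thesis
      by (subst continuous_on_cong[OF refl]) (auto simp: rot_action_def SO_matrix_inv(1))
  qed
  have "continuous_on SO F"
    unfolding F_def by (intro continuous_intros cont xy)
  then have F: "F \<in> borel_measurable \<mu>"
    using borel_measurable_continuous_on_restrict measurable_cong_sets[OF sets refl] by blast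
  have "(\<lambda>g. k' ** g) \<in> measurable (restrict_space borel SO) (restrict_space borel SO)"
  proof (intro measurable_restrict_space3 borel_measurable_continuous_onI)
    show "continuous_on UNIV (\<lambda>g. k' ** g)"
      unfolding matrix_matrix_mult_def by (intro continuous_intros)
  qed (use k' SO_mult in auto)
  then have m: "(\<lambda>g. k' ** g) \<in> measurable \<mu> \<mu>"
    using measurable_cong_sets[OF sets sets] by blast
  have "(LINT h|\<mu>. F h) = (LINT h|\<mu>. F (k' ** h))"
    using integral_distr[OF m F] by (simp add: inv)
  also have "\<dots> = (LINT h|\<mu>. rot_action h P (k *v x) * cnj (rot_action h P (k *v y)))"
  proof (intro Bochner_Integration.integral_cong refl)
    fix h assume "h \<in> space \<mu>"
    then have "matrix_inv (k' ** h) = matrix_inv h ** k"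
      using k k' by (simp add: space SO_matrix_inv_prod k'_def SO_matrix_inv_inv)
    then show "F (k' ** h) = rot_action h P (k *v x) * cnj (rot_action h P (k *v y))"
      by (simp add: F_def rot_action_def matrix_vector_mul_assoc)
  qed
  finally show ?thesis by (simp add: F_def)
qed

text \<open>A rotation mixes the coefficients of degree \<open>n\<close> only among themselves and
  preserves the norm of that component, so Parseval in \<open>H n\<close> gives the claim. Single
  coefficients are not preserved.\<close>

lemma fourier_rot_action_energy:
  fixes P :: "real^'d \<Rightarrow> complex"
  assumes P: "P \<in> sph_polys N" and g: "g \<in> SO"
  shows "(\<Sum>k\<in>I n. (cmod (L2_inner \<omega> (rot_action g P) (Y n k)))\<^sup>2) =
    (\<Sum>k\<in>I n. (cmod (L2_inner \<omega> P (Y n k)))\<^sup>2)"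
proof -
  obtain h where h: "\<And>n. h n \<in> H n" "\<And>n. n > N \<Longrightarrow> h n = (\<lambda>x. 0)" "P = (\<lambda>x. \<Sum>n\<le>N. h n x)"
    using P by (rule sph_polys_obtain) (rule that)
  have 1: "L2_inner \<omega> P (Y n k) = L2_inner \<omega> (h n) (Y n k)" if "k \<in> I n" for k
    unfolding h(3) by (intro sum_components_inner h Y_harmonic that)
  have 2: "L2_inner \<omega> (rot_action g P) (Y n k) = L2_inner \<omega> (rot_action g (h n)) (Y n k)" if "k \<in> I n" for k
    using sum_components_inner[of "\<lambda>n. rot_action g (h n)" N, OF _ _ Y_harmonic[OF that]]
      harmonic_rot_action[OF h(1) g] h(2)
    by (simp add: h(3) rot_action_def)
  have "of_real (\<Sum>k\<in>I n. (cmod (L2_inner \<omega> (rot_action g (h n)) (Y n k)))\<^sup>2) =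
      complex_of_real (\<Sum>k\<in>I n. (cmod (L2_inner \<omega> (h n) (Y n k)))\<^sup>2)"
    unfolding harmonic_parseval[OF h(1)] harmonic_parseval[OF harmonic_rot_action[OF h(1) g]]
    by (intro L2_inner_rot_action g harmonic_continuous[OF h(1)])
  then have "(\<Sum>k\<in>I n. (cmod (L2_inner \<omega> (rot_action g (h n)) (Y n k)))\<^sup>2) =
      (\<Sum>k\<in>I n. (cmod (L2_inner \<omega> (h n) (Y n k)))\<^sup>2)"
    unfolding of_real_eq_iff .
  then show ?thesis by (simp add: 1 2)
qed

text \<open>The degree \<open>n\<close> is independent of \<open>N\<close>: exactness is applied
  only to the rotated \<open>P\<close>, while \<open>v\<close> meets it through an integral over the
  sphere.\<close>

lemma frame_block_scalar:
  fixes P :: "real^'d \<Rightarrow> complex"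
  assumes Q: "quadrature_exact \<mu> (coeff_space \<omega> I Y N) R w g" and g: "\<And>r. r \<in> {1..R} \<Longrightarrow> g r \<in> SO"
    and \<mu>: "is_normalized_Haar_SO \<mu>" and P: "P \<in> sph_polys N"
    and v: "v \<in> H n" and x: "x \<in> sphere 0 1"
  shows "(\<Sum>r=1..R. of_real (w r) * L2_inner \<omega> v (rot_action (g r) P) * rot_action (g r) P x) =
    of_real (inverse (real (card (I n))) * (\<Sum>k\<in>I n. (cmod (L2_inner \<omega> P (Y n k)))\<^sup>2)) * v x"
proof (cases "I n = {}")
  case True
  then have "v = (\<lambda>x. 0)" using harmonic_expansion[OF v] by auto
  then show ?thesis by (simp add: L2_inner_def)
next
  case False
  define B where "B x y = (\<Sum>r=1..R. of_real (w r) * rot_action (g r) P x * cnj (rot_action (g r) P y))" for x y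
  have B_Haar: "B x y = (LINT h|\<mu>. rot_action h P x * cnj (rot_action h P y))" for x y
    unfolding B_def by (rule quadrature_kernel[OF Q g \<mu> P])
  note Pc = sph_polys_continuous[OF P]
  have Tc: "continuous_on (sphere 0 1) (rot_action (g r) P)" if "r \<in> {1..R}" for r
    by (intro rot_action_continuous g that Pc)
  have Bc: "continuous_on (sphere 0 1) (B x)" for x
    unfolding B_def by (intro continuous_intros Tc)
  have Binv: "B (h *v x) (h *v y) = B x y"
    if "h \<in> SO" "x \<in> sphere 0 1" "y \<in> sphere 0 1" for h x y
    unfolding B_Haar by (rule Haar_kernel_invariant[OF \<mu> Pc that])
  obtain c where c: "\<And>v x. v \<in> H n \<Longrightarrow> x \<in> sphere 0 1 \<Longrightarrow> (LINT y|\<omega>. B x y * v y) = c * v x"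
    by (rule invariant_kernel_scalar[of B n]) (rule Bc, erule (2) Binv, rule that, blast)
  have block: "(\<Sum>r=1..R. of_real (w r) * L2_inner \<omega> v (rot_action (g r) P) * rot_action (g r) P x) = c * v x"
    if v: "v \<in> H n" and x: "x \<in> sphere 0 1" for v x
  proof -
    have "(LINT y|\<omega>. B x y * v y) =
        (LINT y|\<omega>. (\<Sum>r=1..R. of_real (w r) * rot_action (g r) P x * (v y * cnj (rot_action (g r) P y))))"
      unfolding B_def sum_distrib_right by (simp add: mult_ac)
    also have "\<dots> = (\<Sum>r=1..R. (LINT y|\<omega>. of_real (w r) * rot_action (g r) P x * (v y * cnj (rot_action (g r) P y))))"
      by (intro Bochner_Integration.integral_sum continuous_integrable continuous_intros
          harmonic_continuous[OF v] Tc)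
    also have "\<dots> = (\<Sum>r=1..R. of_real (w r) * L2_inner \<omega> v (rot_action (g r) P) * rot_action (g r) P x)"
      unfolding Bochner_Integration.integral_mult_right_zero L2_inner_def by (simp only: mult_ac)
    finally show ?thesis using c[OF v x] by simp
  qed
  \<comment> \<open>The diagonal entry of the block at \<open>Y n k\<close>; it is the same number
    for every \<open>k\<close>, which makes the trace computation below possible.\<close>
  have ck: "c = (\<Sum>r=1..R. of_real (w r * (cmod (L2_inner \<omega> (rot_action (g r) P) (Y n k)))\<^sup>2))"
    if k: "k \<in> I n" for k
  proof -
    have "c = L2_inner \<omega> (\<lambda>x. c * Y n k x) (Y n k)"
      by (simp add: L2_inner_cmult_left Y_orthonormal k)
    also have "\<dots> = L2_inner \<omega> (\<lambda>x. \<Sum>r=1..R. (of_real (w r) * L2_inner \<omega> (Y n k) (rot_action (g r) P)) * rot_action (g r) P x) (Y n k)"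
      by (intro L2_inner_cong refl block[symmetric] Y_harmonic k)
    also have "\<dots> = (\<Sum>r=1..R. (of_real (w r) * L2_inner \<omega> (Y n k) (rot_action (g r) P)) * L2_inner \<omega> (rot_action (g r) P) (Y n k))"
      unfolding L2_inner_cmult_left[symmetric]
      by (intro L2_inner_sum_left L2_cmult continuous_L2 Tc Y_continuous k)
    also have "\<dots> = (\<Sum>r=1..R. of_real (w r * (cmod (L2_inner \<omega> (rot_action (g r) P) (Y n k)))\<^sup>2))"
      unfolding of_real_mult complex_norm_square L2_inner_cnj[of \<omega> "Y n k"] by (simp add: mult_ac)
    finally show ?thesis .
  qed
  have "of_nat (card (I n)) * c = (\<Sum>k\<in>I n. c)" by simp
  also have "\<dots> = (\<Sum>k\<in>I n. \<Sum>r=1..R. of_real (w r * (cmod (L2_inner \<omega> (rot_action (g r) P) (Y n k)))\<^sup>2))"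
    by (intro sum.cong refl ck)
  also have "\<dots> = of_real (\<Sum>r=1..R. w r * (\<Sum>k\<in>I n. (cmod (L2_inner \<omega> (rot_action (g r) P) (Y n k)))\<^sup>2))"
    unfolding sum_distrib_left of_real_sum by (rule sum.swap)
  \<comment> \<open>Only after summing over \<open>k\<close> do the inner terms become independent
    of \<open>r\<close>, so that the weights collapse to their total.\<close>
  also have "(\<Sum>r=1..R. w r * (\<Sum>k\<in>I n. (cmod (L2_inner \<omega> (rot_action (g r) P) (Y n k)))\<^sup>2)) =
      (\<Sum>r=1..R. w r) * (\<Sum>k\<in>I n. (cmod (L2_inner \<omega> P (Y n k)))\<^sup>2)"
    unfolding sum_distrib_right by (intro sum.cong refl) (simp add: fourier_rot_action_energy[OF P] g)
  also have "(\<Sum>r=1..R. w r) = 1" by (rule quadrature_weights_sum[OF Q g \<mu>])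
  finally have "of_real (real (card (I n))) * c = of_real (\<Sum>k\<in>I n. (cmod (L2_inner \<omega> P (Y n k)))\<^sup>2)"
    by simp
  moreover have "card (I n) \<noteq> 0" using False by simp
  ultimately have "c = of_real (inverse (real (card (I n))) * (\<Sum>k\<in>I n. (cmod (L2_inner \<omega> P (Y n k)))\<^sup>2))"
    by (simp add: field_simps)
  then show ?thesis using block[OF v x] by simp
qed

end

section \<open>The canonical dual\<close>

context spherical_onb
begin

lemma harmonic_sum_norm:
  assumes v: "\<And>n. v n \<in> H n"
  shows "(L2_norm \<omega> (\<lambda>x. \<Sum>n\<le>M. v n x))\<^sup>2 = (\<Sum>n\<le>M. (L2_norm \<omega> (v n))\<^sup>2)"
proof -
  define u where "u x = (\<Sum>n\<le>M. v n x)" for x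
  have u: "u \<in> L2 \<omega>" unfolding u_def by (intro L2_sum harmonic_L2[OF v])
  have uv: "L2_inner \<omega> u (v n) = L2_inner \<omega> (v n) (v n)" if "n \<le> M" for n
    \<comment> \<open>The family is cut off above \<open>M\<close> to meet the padding
      condition.\<close>
    using sum_components_inner[of "\<lambda>n. if n \<le> M then v n else (\<lambda>x. 0)" M "v n" n] v harmonic_zero that
    by (simp add: u_def[abs_def])
  have "L2_inner \<omega> u u = (\<Sum>n\<le>M. L2_inner \<omega> (v n) u)"
    unfolding u_def by (intro L2_inner_sum_left harmonic_L2[OF v] u[unfolded u_def])
  also have "\<dots> = (\<Sum>n\<le>M. L2_inner \<omega> (v n) (v n))"
  proof (intro sum.cong refl)
    fix n assume "n \<in> {..M}"
    then have "L2_inner \<omega> (v n) u = cnj (L2_inner \<omega> (v n) (v n))"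
      by (subst L2_inner_cnj) (simp add: uv)
    also have "\<dots> = L2_inner \<omega> (v n) (v n)" by (rule L2_inner_cnj[symmetric])
    finally show "L2_inner \<omega> (v n) u = L2_inner \<omega> (v n) (v n)" .
  qed
  finally show ?thesis
    unfolding L2_inner_self of_real_sum[symmetric] of_real_eq_iff u_def .
qed

lemma L2_norm_cong:
  assumes "\<And>x. x \<in> sphere 0 1 \<Longrightarrow> f x = f' x"
  shows "L2_norm \<omega> f = L2_norm \<omega> f'"
proof -
  have "(LINT x|\<omega>. (cmod (f x))\<^sup>2) = (LINT x|\<omega>. (cmod (f' x))\<^sup>2)"
    using assms by (intro Bochner_Integration.integral_cong) (auto simp: space_\<omega>)
  then show ?thesis by (simp add: L2_norm_def)
qed

end

locale rotated_frame = spherical_onb \<omega> I Y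
  for \<omega> :: "(real^'d) measure" and I :: "nat \<Rightarrow> 'k set" and Y :: "nat \<Rightarrow> 'k \<Rightarrow> real^'d \<Rightarrow> complex" +
  fixes \<mu> :: "(real^'d^'d) measure"
    and N R :: "nat \<Rightarrow> nat"
    and g :: "nat \<Rightarrow> nat \<Rightarrow> real^'d^'d"
    and w :: "nat \<Rightarrow> nat \<Rightarrow> real"
    and \<Psi> :: "nat \<Rightarrow> real^'d \<Rightarrow> complex"
  assumes Haar: "is_normalized_Haar_SO \<mu>"
    and g_SO: "\<And>j r. r \<in> {1..R j} \<Longrightarrow> g j r \<in> SO"
    and w_pos: "\<And>j r. r \<in> {1..R j} \<Longrightarrow> w j r > 0"
    and quadrature: "\<And>j. quadrature_exact \<mu> (coeff_space \<omega> I Y (N j)) (R j) (w j) (g j)"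
    and \<Psi>_poly: "\<And>j. \<Psi> j \<in> sph_polys (N j)"
    and frame: "frame_generating \<omega> R w g \<Psi>"
begin

abbreviation \<phi> :: "nat \<times> nat \<Rightarrow> real^'d \<Rightarrow> complex" where "\<phi> \<equiv> rot_system w g \<Psi>"
abbreviation J :: "(nat \<times> nat) set" where "J \<equiv> system_index R"
abbreviation \<sigma> :: "nat \<Rightarrow> real" where "\<sigma> \<equiv> sigma_coeff \<omega> I Y \<Psi>"

text \<open>The eigenvalue of the level-\<open>j\<close> block on \<open>H n\<close>, which is the
  \<open>j\<close>-th term of the series for \<open>\<sigma> n\<close>.\<close>

definition c :: "nat \<Rightarrow> nat \<Rightarrow> real" where
  "c j n = inverse (real (card (I n))) * (\<Sum>k\<in>I n. (cmod (L2_inner \<omega> (\<Psi> j) (Y n k)))\<^sup>2)"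

lemma is_frame: "is_frame \<omega> J \<phi>"
  using frame by (simp add: frame_generating_def)

lemma \<phi>_L2: "p \<in> J \<Longrightarrow> \<phi> p \<in> L2 \<omega>"
  using is_frame by (simp add: is_frame_def)

lemma block:
  assumes v: "v \<in> H n" and x: "x \<in> sphere 0 1"
  shows "(\<Sum>r=1..R j. L2_inner \<omega> v (\<phi> (j, r)) * \<phi> (j, r) x) = of_real (c j n) * v x"
proof -
  have "L2_inner \<omega> v (\<phi> (j, r)) * \<phi> (j, r) x =
      of_real (w j r) * L2_inner \<omega> v (rot_action (g j r) (\<Psi> j)) * rot_action (g j r) (\<Psi> j) x"
    if r: "r \<in> {1..R j}" for r
  proof -
    have "L2_inner \<omega> v (\<phi> (j, r)) = of_real (sqrt (w j r)) * L2_inner \<omega> v (rot_action (g j r) (\<Psi> j))"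
      by (subst (1 2) L2_inner_cnj) (simp add: rot_system_def L2_inner_cmult_left)
    moreover have "of_real (sqrt (w j r)) * of_real (sqrt (w j r)) = complex_of_real (w j r)"
      using w_pos[OF r] by (simp flip: of_real_mult)
    ultimately show ?thesis by (simp add: rot_system_def mult_ac)
  qed
  then have "(\<Sum>r=1..R j. L2_inner \<omega> v (\<phi> (j, r)) * \<phi> (j, r) x) = (\<Sum>r=1..R j.
      of_real (w j r) * L2_inner \<omega> v (rot_action (g j r) (\<Psi> j)) * rot_action (g j r) (\<Psi> j) x)"
    by (intro sum.cong refl)
  also have "\<dots> = of_real (c j n) * v x"
    unfolding c_def by (rule frame_block_scalar[OF quadrature g_SO Haar \<Psi>_poly v x])
  finally show ?thesis .
qed

text \<open>The block identity paired with \<open>v\<close>. It connects the eigenvalues to the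
  frame bounds.\<close>

lemma block_energy:
  assumes v: "v \<in> H n"
  shows "(\<Sum>r=1..R j. (cmod (L2_inner \<omega> v (\<phi> (j, r))))\<^sup>2) = c j n * (L2_norm \<omega> v)\<^sup>2"
proof -
  have J: "(j, r) \<in> J" if "r \<in> {1..R j}" for r using that by (simp add: system_index_def)
  have "of_real (\<Sum>r=1..R j. (cmod (L2_inner \<omega> v (\<phi> (j, r))))\<^sup>2) =
      (\<Sum>r=1..R j. L2_inner \<omega> v (\<phi> (j, r)) * L2_inner \<omega> (\<phi> (j, r)) v)"
    by (simp only: of_real_sum complex_norm_square L2_inner_cnj[of \<omega> "\<phi> _" v])
  also have "\<dots> = L2_inner \<omega> (\<lambda>x. \<Sum>r=1..R j. L2_inner \<omega> v (\<phi> (j, r)) * \<phi> (j, r) x) v"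
    unfolding L2_inner_cmult_left[symmetric]
    by (intro L2_inner_sum_left[symmetric] L2_cmult \<phi>_L2 J harmonic_L2[OF v])
  also have "\<dots> = L2_inner \<omega> (\<lambda>x. of_real (c j n) * v x) v"
    by (intro L2_inner_cong refl block v)
  also have "\<dots> = of_real (c j n * (L2_norm \<omega> v)\<^sup>2)"
    by (simp only: L2_inner_cmult_left L2_inner_self of_real_mult)
  finally show ?thesis unfolding of_real_eq_iff .
qed

text \<open>The frame is tested on a single unit vector \<open>Y n k\<close>. Its frame energy,
  regrouped by levels, is the sum of the \<open>c j n\<close>: summability makes the series defining
  \<open>\<sigma> n\<close> converge, and the lower frame bound keeps it away from 0, so that its
  inverse in the dual coefficients is genuine.\<close>

lemma
  assumes "I n \<noteq> {}"
  shows c_sums: "(\<lambda>j. c j n) sums \<sigma> n" and \<sigma>_pos: "\<sigma> n > 0"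
proof -
  obtain k where k: "k \<in> I n" using assms by auto
  obtain A where A: "A > 0"
    and fr: "\<And>f. f \<in> L2 \<omega> \<Longrightarrow> (\<lambda>i. (cmod (L2_inner \<omega> f (\<phi> i)))\<^sup>2) summable_on J"
      "\<And>f. f \<in> L2 \<omega> \<Longrightarrow> A * (L2_norm \<omega> f)\<^sup>2 \<le> (\<Sum>\<^sub>\<infinity>i\<in>J. (cmod (L2_inner \<omega> f (\<phi> i)))\<^sup>2)"
    using is_frame unfolding is_frame_def by blast
  define a where "a p = (cmod (L2_inner \<omega> (Y n k) (\<phi> p)))\<^sup>2" for p
  have norm: "(L2_norm \<omega> (Y n k))\<^sup>2 = 1"
    using L2_inner_self[of \<omega> "Y n k"] Y_orthonormal[OF k k] by (metis of_real_eq_1_iff)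
  have "(a has_sum infsum a J) (SIGMA j:UNIV. {1..R j})"
    using fr(1)[OF Y_L2[OF k]] by (simp add: a_def[abs_def] system_index_def)
  moreover have "((\<lambda>r. a (j, r)) has_sum c j n) {1..R j}" for j
    using block_energy[OF Y_harmonic[OF k], of j] norm
    by (intro has_sum_finiteI) (simp_all add: a_def)
  ultimately have "((\<lambda>j. c j n) has_sum infsum a J) UNIV" by (rule has_sum_SigmaD)
  then have s: "(\<lambda>j. c j n) sums infsum a J" by (rule has_sum_imp_sums)
  have d: "real (card (I n)) \<noteq> 0" using assms by simp
  have "(\<lambda>j. real (card (I n)) * c j n) sums (real (card (I n)) * infsum a J)"
    using s by (rule sums_mult)
  moreover have "real (card (I n)) * c j n = (\<Sum>k\<in>I n. (cmod (fourier \<omega> Y (\<Psi> j) n k))\<^sup>2)" for j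
    using d by (simp add: c_def fourier_def)
  ultimately have "(\<Sum>j. \<Sum>k\<in>I n. (cmod (fourier \<omega> Y (\<Psi> j) n k))\<^sup>2) = real (card (I n)) * infsum a J"
    by (simp add: sums_iff)
  moreover have "cfun_dim (H n) = card (I n)" using onb by (simp add: harmonic_onb_def)
  ultimately have \<sigma>: "\<sigma> n = infsum a J" using d by (simp add: sigma_coeff_def)
  show "(\<lambda>j. c j n) sums \<sigma> n" using s by (simp add: \<sigma>)
  have "A \<le> infsum a J" using fr(2)[OF Y_L2[OF k]] by (simp add: norm a_def[abs_def])
  then show "\<sigma> n > 0" using A \<sigma> by simp
qed

text \<open>Truncating after complete levels leaves an error with finitely many orthogonal
  components, each a multiple of \<open>v n\<close> by the tail of the series for
  \<open>\<sigma> n\<close>. Pythagoras then reduces norm convergence to numerical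
  convergence.\<close>

lemma frame_operator_on_polys:
  assumes v: "\<And>n. v n \<in> H n"
  shows "frame_operator_maps \<omega> J \<phi> (\<lambda>x. \<Sum>n\<le>M. v n x) (\<lambda>x. \<Sum>n\<le>M. of_real (\<sigma> n) * v n x)"
proof (rule frame_operator_mapsI[OF is_frame, where G = "\<lambda>m. SIGMA j:{..<m}. {1..R j}"])
  let ?u = "\<lambda>x. \<Sum>n\<le>M. v n x"
  show "?u \<in> L2 \<omega>" "(\<lambda>x. \<Sum>n\<le>M. of_real (\<sigma> n) * v n x) \<in> L2 \<omega>"
    by (intro L2_sum L2_cmult harmonic_L2[OF v])+
  show "finite (SIGMA j:{..<m}. {1..R j})" "(SIGMA j:{..<m}. {1..R j}) \<subseteq> J" for m
    by (auto simp: system_index_def)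
  show "eventually (\<lambda>m. F \<subseteq> (SIGMA j:{..<m}. {1..R j})) sequentially" if F: "finite F" "F \<subseteq> J" for F
  proof -
    have "F \<subseteq> (SIGMA j:{..<m}. {1..R j})" if m: "m \<ge> Suc (Max (fst ` F))" for m
    proof
      fix p assume p: "p \<in> F"
      then have "fst p \<le> Max (fst ` F)" using F(1) by (intro Max_ge) auto
      then show "p \<in> (SIGMA j:{..<m}. {1..R j})"
        using p F(2) m by (cases p) (auto simp: system_index_def)
    qed
    then show ?thesis unfolding eventually_sequentially by blast
  qed
  define \<delta> where "\<delta> m n = complex_of_real (\<sigma> n - (\<Sum>j<m. c j n))" for m n
  have eq: "(\<Sum>n\<le>M. of_real (\<sigma> n) * v n x) -
      (\<Sum>i\<in>(SIGMA j:{..<m}. {1..R j}). L2_inner \<omega> ?u (\<phi> i) * \<phi> i x) = (\<Sum>n\<le>M. \<delta> m n * v n x)"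
    if x: "x \<in> sphere 0 1" for m x
  proof -
    have "(\<Sum>i\<in>(SIGMA j:{..<m}. {1..R j}). L2_inner \<omega> ?u (\<phi> i) * \<phi> i x) =
        (\<Sum>j<m. \<Sum>r=1..R j. L2_inner \<omega> ?u (\<phi> (j, r)) * \<phi> (j, r) x)"
      by (subst sum.Sigma) (auto intro!: sum.cong)
    also have "\<dots> = (\<Sum>j<m. \<Sum>r=1..R j. \<Sum>n\<le>M. L2_inner \<omega> (v n) (\<phi> (j, r)) * \<phi> (j, r) x)"
    proof (intro sum.cong refl)
      fix j r assume "r \<in> {1..R j}"
      then have "\<phi> (j, r) \<in> L2 \<omega>" by (intro \<phi>_L2) (simp add: system_index_def)
      then have "L2_inner \<omega> ?u (\<phi> (j, r)) = (\<Sum>n\<le>M. L2_inner \<omega> (v n) (\<phi> (j, r)))"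
        by (intro L2_inner_sum_left harmonic_L2[OF v])
      then show "L2_inner \<omega> ?u (\<phi> (j, r)) * \<phi> (j, r) x = (\<Sum>n\<le>M. L2_inner \<omega> (v n) (\<phi> (j, r)) * \<phi> (j, r) x)"
        by (simp add: sum_distrib_right)
    qed
    also have "\<dots> = (\<Sum>j<m. \<Sum>n\<le>M. of_real (c j n) * v n x)"
      by (rule sum.cong[OF refl], subst sum.swap) (rule sum.cong[OF refl], rule block[OF v x])
    also have "\<dots> = (\<Sum>n\<le>M. (\<Sum>j<m. of_real (c j n)) * v n x)"
      unfolding sum_distrib_right by (rule sum.swap)
    finally show ?thesis by (simp add: \<delta>_def left_diff_distrib sum_subtractf)
  qed
  \<comment> \<open>Convergence of the eigenvalue series is available for nonempty
    \<open>I n\<close>; otherwise \<open>v n\<close> is 0.\<close>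
  have "(\<lambda>m. cmod (\<delta> m n) * L2_norm \<omega> (v n)) \<longlonglongrightarrow> 0" for n
  proof (cases "I n = {}")
    case True
    then have "v n = (\<lambda>x. 0)" using harmonic_expansion[OF v[of n]] by auto
    then show ?thesis by (simp add: L2_norm_def)
  next
    case False
    have "(\<lambda>m. \<Sum>j<m. c j n) \<longlonglongrightarrow> \<sigma> n" using c_sums[OF False] by (simp add: sums_def)
    then have "(\<lambda>m. cmod (\<delta> m n) * L2_norm \<omega> (v n)) \<longlonglongrightarrow>
        cmod (of_real (\<sigma> n - \<sigma> n)) * L2_norm \<omega> (v n)"
      unfolding \<delta>_def by (intro tendsto_intros)
    then show ?thesis by simp
  qed
  then have "(\<lambda>m. sqrt (\<Sum>n\<le>M. (cmod (\<delta> m n) * L2_norm \<omega> (v n))\<^sup>2)) \<longlonglongrightarrow> sqrt (\<Sum>n\<le>M. 0\<^sup>2)"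
    by (intro tendsto_intros)
  moreover have "sqrt (\<Sum>n\<le>M. (cmod (\<delta> m n) * L2_norm \<omega> (v n))\<^sup>2) =
      L2_norm \<omega> (\<lambda>x. (\<Sum>n\<le>M. of_real (\<sigma> n) * v n x) -
        (\<Sum>i\<in>(SIGMA j:{..<m}. {1..R j}). L2_inner \<omega> ?u (\<phi> i) * \<phi> i x))" for m
  proof -
    have "(\<Sum>n\<le>M. (cmod (\<delta> m n) * L2_norm \<omega> (v n))\<^sup>2) = (L2_norm \<omega> (\<lambda>x. \<Sum>n\<le>M. \<delta> m n * v n x))\<^sup>2"
      unfolding L2_norm_cmult[symmetric] by (intro harmonic_sum_norm[symmetric] harmonic_cmult v)
    also have "L2_norm \<omega> (\<lambda>x. \<Sum>n\<le>M. \<delta> m n * v n x) =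
      L2_norm \<omega> (\<lambda>x. (\<Sum>n\<le>M. of_real (\<sigma> n) * v n x) -
        (\<Sum>i\<in>(SIGMA j:{..<m}. {1..R j}). L2_inner \<omega> ?u (\<phi> i) * \<phi> i x))"
      by (rule L2_norm_cong) (rule eq[symmetric])
    finally show ?thesis by (simp add: L2_norm_nonneg)
  qed
  ultimately show "(\<lambda>m. L2_norm \<omega> (\<lambda>x. (\<Sum>n\<le>M. of_real (\<sigma> n) * v n x) -
        (\<Sum>i\<in>(SIGMA j:{..<m}. {1..R j}). L2_inner \<omega> ?u (\<phi> i) * \<phi> i x))) \<longlonglongrightarrow> 0"
    by simp
qed

text \<open>Equality of Fourier coefficients makes each component of \<open>\<Psi> j\<close> the
  \<open>\<sigma> n\<close>-fold of that of \<open>\<Psi>' j\<close>. Rotations respect degrees, so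
  the relation survives rotation and weighting and is exactly what the frame operator
  produces.\<close>

lemma frame_operator_rot_system:
  assumes p: "p \<in> J" and poly: "\<And>j. \<exists>L. \<Psi>' j \<in> sph_polys L"
    and dual: "\<And>j n k. k \<in> I n \<Longrightarrow>
      fourier \<omega> Y (\<Psi>' j) n k = inverse (of_real (\<sigma> n)) * fourier \<omega> Y (\<Psi> j) n k"
  shows "frame_operator_maps \<omega> J \<phi> (rot_system w g \<Psi>' p) (\<phi> p)"
proof -
  obtain j r where p_eq: "p = (j, r)" and r: "r \<in> {1..R j}"
    using p by (auto simp: system_index_def)
  obtain L where L: "\<Psi>' j \<in> sph_polys L" using poly by blast
  obtain h where h: "\<And>n. h n \<in> H n" "\<And>n. n > N j \<Longrightarrow> h n = (\<lambda>x. 0)" "\<Psi> j = (\<lambda>x. \<Sum>n\<le>N j. h n x)"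
    using \<Psi>_poly[of j] by (rule sph_polys_obtain) (rule that)
  obtain h' where h': "\<And>n. h' n \<in> H n" "\<And>n. n > L \<Longrightarrow> h' n = (\<lambda>x. 0)" "\<Psi>' j = (\<lambda>x. \<Sum>n\<le>L. h' n x)"
    using L by (rule sph_polys_obtain) (rule that)
  \<comment> \<open>The formal degree bound \<open>L\<close> of \<open>\<Psi>' j\<close> is
    unrelated to \<open>N j\<close>; a common bound puts both expansions over the same
    range.\<close>
  define M where "M = max (N j) L"
  have comp: "h n x = of_real (\<sigma> n) * h' n x" for n x
  proof (cases "I n = {}")
    case True
    then show ?thesis using harmonic_expansion[OF h(1)[of n], of x] harmonic_expansion[OF h'(1)[of n], of x]
      by simp
  next
    case False
    have "L2_inner \<omega> (h n) (Y n k) = of_real (\<sigma> n) * L2_inner \<omega> (h' n) (Y n k)" if k: "k \<in> I n" for k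
    proof -
      have "L2_inner \<omega> (h n) (Y n k) = fourier \<omega> Y (\<Psi> j) n k"
        unfolding fourier_def h(3) by (intro sum_components_inner[symmetric] h Y_harmonic k)
      moreover have "L2_inner \<omega> (h' n) (Y n k) = fourier \<omega> Y (\<Psi>' j) n k"
        unfolding fourier_def h'(3) by (intro sum_components_inner[symmetric] h' Y_harmonic k)
      ultimately show ?thesis using dual[OF k, of j] \<sigma>_pos[OF False] by simp
    qed
    then show ?thesis
      unfolding harmonic_expansion[OF h(1)[of n], of x] harmonic_expansion[OF h'(1)[of n], of x]
        sum_distrib_left by (intro sum.cong refl) simp
  qed
  have \<Psi>M: "\<Psi> j x = (\<Sum>n\<le>M. h n x)" for x
    unfolding h(3) by (intro sum.mono_neutral_left) (auto simp: M_def h(2))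
  have \<Psi>'M: "\<Psi>' j x = (\<Sum>n\<le>M. h' n x)" for x
    unfolding h'(3) by (intro sum.mono_neutral_left) (auto simp: M_def h'(2))
  define v where "v n x = of_real (sqrt (w j r)) * rot_action (g j r) (h' n) x" for n x
  have v: "v n \<in> H n" for n
    unfolding v_def by (intro harmonic_cmult harmonic_rot_action h' g_SO r)
  have "rot_system w g \<Psi>' p = (\<lambda>x. \<Sum>n\<le>M. v n x)"
    by (simp add: p_eq rot_system_def rot_action_def \<Psi>'M v_def sum_distrib_left)
  moreover have "\<phi> p = (\<lambda>x. \<Sum>n\<le>M. of_real (\<sigma> n) * v n x)"
    by (simp add: p_eq rot_system_def rot_action_def \<Psi>M v_def comp sum_distrib_left mult.left_commute)
  ultimately show ?thesis using frame_operator_on_polys[OF v, of M] by simp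
qed

end

theorem proposition3p3:
  fixes \<omega> :: "(real^'d) measure"
    and \<mu> :: "(real^'d^'d) measure"
    and I :: "nat \<Rightarrow> 'k set"
    and Y :: "nat \<Rightarrow> 'k \<Rightarrow> real^'d \<Rightarrow> complex"
    and N R :: "nat \<Rightarrow> nat"
    and g :: "nat \<Rightarrow> nat \<Rightarrow> real^'d^'d"
    and w :: "nat \<Rightarrow> nat \<Rightarrow> real"
    and \<Psi> \<Psi>' :: "nat \<Rightarrow> real^'d \<Rightarrow> complex"
  assumes "CARD('d) \<ge> 3"
    and "is_normalized_sphere_measure \<omega>"
    and "is_normalized_Haar_SO \<mu>"
    and "harmonic_onb \<omega> I Y"
    and "mono N"
    and "\<And>j r. r \<in> {1..R j} \<Longrightarrow> g j r \<in> SO"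
    and "\<And>j r. r \<in> {1..R j} \<Longrightarrow> w j r > 0"
    and "\<And>j. quadrature_exact \<mu> (coeff_space \<omega> I Y (N j)) (R j) (w j) (g j)"
    and "\<And>j. \<Psi> j \<in> sph_polys (N j)"
    and "frame_generating \<omega> R w g \<Psi>"
    and "\<And>j. \<exists>L. \<Psi>' j \<in> sph_polys L"
    and "\<And>j n k. k \<in> I n \<Longrightarrow>
           fourier \<omega> Y (\<Psi>' j) n k = inverse (of_real (sigma_coeff \<omega> I Y \<Psi> n)) * fourier \<omega> Y (\<Psi> j) n k"
  shows "is_canonical_dual_frame \<omega> (system_index R) (rot_system w g \<Psi>) (rot_system w g \<Psi>')"
proof -
  interpret rotated_frame \<omega> I Y \<mu> N R g w \<Psi>
    by unfold_locales (fact assms)+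
  show ?thesis
    by (intro is_canonical_dual_frameI is_frame frame_operator_rot_system assms(11,12))
qed

end
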